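(* Let $\mathcal{P}$ be a reparametrization category with cuts, equipped with a cut structure $(\delta,c_1,c_2,\Theta)$, let $D,E$ be arbitrary $\mathcal{P}$-spaces, and let $L\in\mathrm{Obj}(\mathcal{P})$. Then the maps $$r_L:(D\otimes E)(L)\longrightarrow D(L)\times E(L),\qquad r_L[\psi,x,y]=\bigl(D(c_1^{a,b}(\psi))x,\;E(c_2^{a,b}(\psi))y\bigr)$$ (for $\psi\in\mathcal{P}(L,a\otimes b)$, $x\in D(a)$, $y\in E(b)$) and $$s_L:D(L)\times E(L)\longrightarrow (D\otimes E)(L),\qquad s_L(x,y)=[\delta_L,x,y]$$ are homotopy inverses of each other. Thus, naturally in $D$ and $E$, there is a homotopy equivalence $(D\otimes E)(L)\simeq D(L)\times E(L)$. No cofibrancy hypothesis on $D$ or $E$ is required.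
   Context: $\mathrm{Top}$ denotes either the category of $\Delta$-generated spaces (spaces whose topology is final with respect to all continuous maps from standard topological simplices) or its full subcategory of $\Delta$-Hausdorff ones (those for which the image of every continuous map $[0,1]\to X$ is closed). In either case $\mathrm{Top}$ is complete, cocomplete and cartesian closed; products and mapping spaces are taken in $\mathrm{Top}$. A reparametrization category $(\mathcal{P},\otimes)$ is a small $\mathrm{Top}$-enriched semimonoidal category (an enriched bifunctor $\otimes$, associative, with no unit required) such that: (1) the semimonoidal structure is strict (so $\otimes$ makes $\mathrm{Obj}(\mathcal{P})$ a semigroup); (2) every hom-space $\mathcal{P}(\ell,\ell')$ is contractible; (3) if $\phi:\ell\to\ell'$ and $\ell'=\ell'_1\otimes\ell'_2$, there are objects $\ell_1,\ell_2$ and maps $\phi_i:\ell_i\to\ell'_i$ with $\ell=\ell_1\otimes\ell_2$ and $\phi=\phi_1\otimes\phi_2$. A cut structure on $\mathcal{P}$ consists of: for every object $L$ a map $\delta_L:L\to L\otimes L$ (not required to be natural); for all objects $L,a,b$ continuous maps $c_1^{a,b}:\mathcal{P}(L,a\otimes b)\to\mathcal{P}(L,a)$ and $c_2^{a,b}:\mathcal{P}(L,a\otimes b)\to\mathcal{P}(L,b)$ such that for all $\alpha:a\to a'$, $\beta:b\to b'$, $\psi:L\to a\otimes b$ one has $c_1^{a',b'}((\alpha\otimes\beta)\psi)=\alpha c_1^{a,b}(\psi)$ and $c_2^{a',b'}((\alpha\otimes\beta)\psi)=\beta c_2^{a,b}(\psi)$; and, putting $N_L^{a,b}(\psi)=(c_1^{a,b}(\psi)\otimes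 c_2^{a,b}(\psi))\delta_L$, continuous maps $\Theta_L^{a,b}:[0,1]\times\mathcal{P}(L,a\otimes b)\to\mathcal{P}(L,a\otimes b)$ with $\Theta_L^{a,b}(0,\psi)=\psi$, $\Theta_L^{a,b}(1,\psi)=N_L^{a,b}(\psi)$ and $\Theta_L^{a',b'}(u,(\alpha\otimes\beta)\psi)=(\alpha\otimes\beta)\Theta_L^{a,b}(u,\psi)$. A reparametrization category with cuts is a reparametrization category that admits a cut structure. A $\mathcal{P}$-space is an enriched functor $D:\mathcal{P}^{\mathrm{op}}\to\mathrm{Top}$. The tensor product of $\mathcal{P}$-spaces is $(D\otimes E)(L)=\int^{a,b\in\mathrm{Obj}(\mathcal{P})}\mathcal{P}(L,a\otimes b)\times D(a)\times E(b)$ (enriched coend), i.e. the quotient in $\mathrm{Top}$ of $\coprod_{a,b}\mathcal{P}(L,a\otimes b)\times D(a)\times E(b)$ by the relation generated by $[(\alpha\otimes\beta)\psi,x',y']=[\psi,D(\alpha)x',E(\beta)y']$ for $\alpha:a\to a'$, $\beta:b\to b'$, $\psi\in\mathcal{P}(L,a\otimes b)$, $x'\in D(a')$, $y'\in E(b')$; $[\psi,x,y]$ denotes the class of $(\psi,x,y)$. The $\mathcal{P}$-action is $(D\otimes E)(\theta)[\psi,x,y]=[\psi\theta,x,y]$. The maps $r_L$ and $s_L$ are well defined and continuous. *)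

theory Defs
  imports "HOL-Analysis.Analysis" "HOL-Homology.Simplices"
begin

section \<open>Convenient categories of spaces\<close>

abbreviation simplex_space :: "nat \<Rightarrow> (nat \<Rightarrow> real) topology" where
  "simplex_space n \<equiv> subtopology (powertop_real UNIV) (standard_simplex n)"

definition delta_open :: "'a topology \<Rightarrow> 'a set \<Rightarrow> bool" where
  "delta_open X U \<longleftrightarrow> U \<subseteq> topspace X \<and>
     (\<forall>n \<sigma>. continuous_map (simplex_space n) X \<sigma> \<longrightarrow>
        openin (simplex_space n) {t \<in> topspace (simplex_space n). \<sigma> t \<in> U})"

definition delta_generated :: "'a topology \<Rightarrow> bool" where
  "delta_generated X \<longleftrightarrow> (\<forall>U. delta_open X U \<longrightarrow> openin X U)"

definition delta_Hausdorff :: "'a topology \<Rightarrow> bool" where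
  "delta_Hausdorff X \<longleftrightarrow> (\<forall>\<gamma>. pathin X \<gamma> \<longrightarrow> closedin X (\<gamma> ` {0..1}))"

text \<open>The two possible meanings of Top, and its objects.\<close>

datatype top_kind = All_Delta_Generated | Only_Delta_Hausdorff

definition in_Top :: "top_kind \<Rightarrow> 'a topology \<Rightarrow> bool" where
  "in_Top T X \<longleftrightarrow> delta_generated X \<and> (T = Only_Delta_Hausdorff \<longrightarrow> delta_Hausdorff X)"

text \<open>The coreflection of an arbitrary space into the Delta-generated ones: same points, with
  the final topology with respect to all singular simplices.\<close>

definition delta_kelley :: "'a topology \<Rightarrow> 'a topology" where
  "delta_kelley X = topology (delta_open X)"

lemma istopology_delta_open: "istopology (delta_open X)"
proof -
  have int: "{t \<in> S. \<sigma> t \<in> A \<inter> B} = {t \<in> S. \<sigma> t \<in> A} \<inter> {t \<in> S. \<sigma> t \<in> B}"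
    for \<sigma> :: "(nat \<Rightarrow> real) \<Rightarrow> 'a" and S A B by blast
  have un: "{t \<in> S. \<sigma> t \<in> \<Union>K} = \<Union>((\<lambda>A. {t \<in> S. \<sigma> t \<in> A}) ` K)"
    for \<sigma> :: "(nat \<Rightarrow> real) \<Rightarrow> 'a" and S K by blast
  show ?thesis
    unfolding istopology_def
  proof (intro conjI allI impI)
    fix A B assume "delta_open X A" "delta_open X B"
    then show "delta_open X (A \<inter> B)"
      unfolding delta_open_def int by (meson openin_Int le_infI1)
  next
    fix K assume "\<forall>A\<in>K. delta_open X A"
    then show "delta_open X (\<Union>K)"
      unfolding delta_open_def un by (auto intro!: openin_Union simp del: openin_subtopology)
  qed
qed

lemma openin_delta_kelley: "openin (delta_kelley X) = delta_open X"
  unfolding delta_kelley_def by (rule topology_inverse'[OF istopology_delta_open])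

text \<open>Binary products in Top. The Delta-Hausdorff spaces are closed under these products and under the
  mapping spaces below, so the same formulas serve for both meanings of Top. Coproducts are
  topological disjoint sums.\<close>

definition Top_prod :: "'a topology \<Rightarrow> 'b topology \<Rightarrow> ('a \<times> 'b) topology" where
  "Top_prod X Y = delta_kelley (prod_topology X Y)"

text \<open>The mapping space TOP(X,Y): the Delta-kelleyfication of the compact-open topology. Its points
  are the continuous maps, represented by functions undefined off the underlying set of X.\<close>

definition maps :: "'a topology \<Rightarrow> 'b topology \<Rightarrow> ('a \<Rightarrow> 'b) set" where
  "maps X Y = {f \<in> extensional (topspace X). continuous_map X Y f}"

definition compact_open_topology :: "'a topology \<Rightarrow> 'b topology \<Rightarrow> ('a \<Rightarrow> 'b) topology" where
  "compact_open_topology X Y =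
     topology_generated_by {{f \<in> maps X Y. f ` K \<subseteq> U} |K U. compactin X K \<and> openin Y U}"

definition Top_map :: "'a topology \<Rightarrow> 'b topology \<Rightarrow> ('a \<Rightarrow> 'b) topology" where
  "Top_map X Y = delta_kelley (compact_open_topology X Y)"

text \<open>For an equivalence relation R on the points of X, the usual quotient topology on the set of
  classes: a set of classes is open iff its union is open in X.\<close>

definition quotient_space :: "'a topology \<Rightarrow> ('a \<times> 'a) set \<Rightarrow> 'a set topology" where
  "quotient_space X R = topology (\<lambda>\<U>. \<U> \<subseteq> topspace X // R \<and> openin X (\<Union>\<U>))"

lemma openin_quotient_space:
  assumes "equiv (topspace X) R"
  shows "openin (quotient_space X R) \<U> \<longleftrightarrow> \<U> \<subseteq> topspace X // R \<and> openin X (\<Union>\<U>)"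
proof -
  have int: "\<Union>(A \<inter> B) = \<Union>A \<inter> \<Union>B"
    if "A \<subseteq> topspace X // R" "B \<subseteq> topspace X // R" for A B
  proof
    show "\<Union>A \<inter> \<Union>B \<subseteq> \<Union>(A \<inter> B)"
    proof
      fix x assume "x \<in> \<Union>A \<inter> \<Union>B"
      then obtain C C' where C: "C \<in> A" "C' \<in> B" "x \<in> C" "x \<in> C'" by blast
      then have "C = C'" using that quotient_disj[OF assms, of C C'] by blast
      with C show "x \<in> \<Union>(A \<inter> B)" by blast
    qed
  qed blast
  have un: "openin X (\<Union>(\<Union>K))" if "\<forall>A\<in>K. openin X (\<Union>A)" for K :: "'a set set set"
  proof -
    have "\<Union>(\<Union>K) = \<Union>((\<lambda>A. \<Union>A) ` K)" by blast
    moreover have "openin X (\<Union>((\<lambda>A. \<Union>A) ` K))"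
      by (rule openin_Union) (use that in blast)
    ultimately show ?thesis by metis
  qed
  have "istopology (\<lambda>\<U>. \<U> \<subseteq> topspace X // R \<and> openin X (\<Union>\<U>))"
    unfolding istopology_def
  proof (intro conjI allI impI)
    fix A B assume "A \<subseteq> topspace X // R \<and> openin X (\<Union>A)" "B \<subseteq> topspace X // R \<and> openin X (\<Union>B)"
    then show "A \<inter> B \<subseteq> topspace X // R" "openin X (\<Union>(A \<inter> B))"
      using int[of A B] openin_Int[of X "\<Union>A" "\<Union>B"] by auto
  next
    fix K assume "\<forall>A\<in>K. A \<subseteq> topspace X // R \<and> openin X (\<Union>A)"
    then show "\<Union>K \<subseteq> topspace X // R" "openin X (\<Union>(\<Union>K))"
      using un[of K] by blast+
  qed
  from topology_inverse'[OF this] show ?thesis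
    unfolding quotient_space_def by simp
qed

text \<open>The quotient in Top of X by the relation generated by R0: the quotient by the smallest
  equivalence relation containing R0 whose quotient space is an object of Top. Quotients of
  Delta-generated spaces are Delta-generated, so in the first meaning of Top this is the
  equivalence relation generated by R0; in the second it is the kernel of the reflection
  of that quotient into the Delta-Hausdorff spaces.\<close>

definition Top_equiv :: "top_kind \<Rightarrow> 'a topology \<Rightarrow> ('a \<times> 'a) set \<Rightarrow> ('a \<times> 'a) set" where
  "Top_equiv T X R0 =
     \<Inter>{R. equiv (topspace X) R \<and> R0 \<subseteq> R \<and> in_Top T (quotient_space X R)}"

definition Top_quotient :: "top_kind \<Rightarrow> 'a topology \<Rightarrow> ('a \<times> 'a) set \<Rightarrow> 'a set topology" where
  "Top_quotient T X R0 = quotient_space X (Top_equiv T X R0)"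


section \<open>Reparametrization categories\<close>

text \<open>All operations carry their source and target objects as arguments, so that hom-spaces need
  not be disjoint: \<open>Comp P a b c g f\<close> is the composite of \<open>f : a \<rightarrow> b\<close> and \<open>g : b \<rightarrow> c\<close>, and
  \<open>tmor P a a' b b' \<alpha> \<beta>\<close> is the tensor product of \<open>\<alpha> : a \<rightarrow> a'\<close> and \<open>\<beta> : b \<rightarrow> b'\<close>.\<close>

record ('o, 'm) semimonoidal =
  Ob :: "'o set"
  Hom :: "'o \<Rightarrow> 'o \<Rightarrow> 'm topology"
  Idn :: "'o \<Rightarrow> 'm"
  Comp :: "'o \<Rightarrow> 'o \<Rightarrow> 'o \<Rightarrow> 'm \<Rightarrow> 'm \<Rightarrow> 'm"
  tob :: "'o \<Rightarrow> 'o \<Rightarrow> 'o"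
  tmor :: "'o \<Rightarrow> 'o \<Rightarrow> 'o \<Rightarrow> 'o \<Rightarrow> 'm \<Rightarrow> 'm \<Rightarrow> 'm"

abbreviation mor :: "('o, 'm) semimonoidal \<Rightarrow> 'o \<Rightarrow> 'o \<Rightarrow> 'm set" where
  "mor P a b \<equiv> topspace (Hom P a b)"

locale Top_category =
  fixes T :: top_kind and P :: "('o, 'm) semimonoidal"
  assumes Hom_in_Top: "\<lbrakk>a \<in> Ob P; b \<in> Ob P\<rbrakk> \<Longrightarrow> in_Top T (Hom P a b)"
    and Idn_mor: "a \<in> Ob P \<Longrightarrow> Idn P a \<in> mor P a a"
    and Comp_continuous: "\<lbrakk>a \<in> Ob P; b \<in> Ob P; c \<in> Ob P\<rbrakk> \<Longrightarrow>
        continuous_map (Top_prod (Hom P b c) (Hom P a b)) (Hom P a c) (\<lambda>(g, f). Comp P a b c g f)"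
    and Comp_Idn_left: "\<lbrakk>a \<in> Ob P; b \<in> Ob P; f \<in> mor P a b\<rbrakk> \<Longrightarrow> Comp P a b b (Idn P b) f = f"
    and Comp_Idn_right: "\<lbrakk>a \<in> Ob P; b \<in> Ob P; f \<in> mor P a b\<rbrakk> \<Longrightarrow> Comp P a a b f (Idn P a) = f"
    and Comp_assoc: "\<lbrakk>a \<in> Ob P; b \<in> Ob P; c \<in> Ob P; d \<in> Ob P;
          f \<in> mor P a b; g \<in> mor P b c; h \<in> mor P c d\<rbrakk> \<Longrightarrow>
        Comp P a c d h (Comp P a b c g f) = Comp P a b d (Comp P b c d h g) f"

locale strict_semimonoidal_Top_category = Top_category +
  assumes tob_Ob: "\<lbrakk>a \<in> Ob P; b \<in> Ob P\<rbrakk> \<Longrightarrow> tob P a b \<in> Ob P"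
    and tmor_continuous: "\<lbrakk>a \<in> Ob P; a' \<in> Ob P; b \<in> Ob P; b' \<in> Ob P\<rbrakk> \<Longrightarrow>
        continuous_map (Top_prod (Hom P a a') (Hom P b b')) (Hom P (tob P a b) (tob P a' b'))
          (\<lambda>(\<alpha>, \<beta>). tmor P a a' b b' \<alpha> \<beta>)"
    and tmor_Idn: "\<lbrakk>a \<in> Ob P; b \<in> Ob P\<rbrakk> \<Longrightarrow>
        tmor P a a b b (Idn P a) (Idn P b) = Idn P (tob P a b)"
    and tmor_Comp: "\<lbrakk>a \<in> Ob P; a' \<in> Ob P; a'' \<in> Ob P; b \<in> Ob P; b' \<in> Ob P; b'' \<in> Ob P;
          \<alpha> \<in> mor P a a'; \<alpha>' \<in> mor P a' a''; \<beta> \<in> mor P b b'; \<beta>' \<in> mor P b' b''\<rbrakk> \<Longrightarrow>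
        tmor P a a'' b b'' (Comp P a a' a'' \<alpha>' \<alpha>) (Comp P b b' b'' \<beta>' \<beta>) =
        Comp P (tob P a b) (tob P a' b') (tob P a'' b'')
          (tmor P a' a'' b' b'' \<alpha>' \<beta>') (tmor P a a' b b' \<alpha> \<beta>)"
    and tob_assoc: "\<lbrakk>a \<in> Ob P; b \<in> Ob P; c \<in> Ob P\<rbrakk> \<Longrightarrow> tob P (tob P a b) c = tob P a (tob P b c)"
    and tmor_assoc: "\<lbrakk>a \<in> Ob P; a' \<in> Ob P; b \<in> Ob P; b' \<in> Ob P; c \<in> Ob P; c' \<in> Ob P;
          \<alpha> \<in> mor P a a'; \<beta> \<in> mor P b b'; \<gamma> \<in> mor P c c'\<rbrakk> \<Longrightarrow>
        tmor P (tob P a b) (tob P a' b') c c' (tmor P a a' b b' \<alpha> \<beta>) \<gamma> =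
        tmor P a a' (tob P b c) (tob P b' c') \<alpha> (tmor P b b' c c' \<beta> \<gamma>)"

text \<open>The library's \<open>contractible_space\<close> holds of the empty space, hence \<open>Hom_nonempty\<close>.\<close>

locale reparametrization_category = strict_semimonoidal_Top_category +
  assumes Hom_contractible: "\<lbrakk>a \<in> Ob P; b \<in> Ob P\<rbrakk> \<Longrightarrow> contractible_space (Hom P a b)"
    and Hom_nonempty: "\<lbrakk>a \<in> Ob P; b \<in> Ob P\<rbrakk> \<Longrightarrow> mor P a b \<noteq> {}"
    and decomposition: "\<lbrakk>l \<in> Ob P; l1' \<in> Ob P; l2' \<in> Ob P; \<phi> \<in> mor P l (tob P l1' l2')\<rbrakk> \<Longrightarrow>
        \<exists>l1\<in>Ob P. \<exists>l2\<in>Ob P. \<exists>\<phi>1\<in>mor P l1 l1'. \<exists>\<phi>2\<in>mor P l2 l2'.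
          l = tob P l1 l2 \<and> \<phi> = tmor P l1 l1' l2 l2' \<phi>1 \<phi>2"

text \<open>\<open>post_tensor P L a a' b b' \<alpha> \<beta> \<psi>\<close> is the composite
  \<open>L \<rightarrow> a \<otimes> b \<rightarrow> a' \<otimes> b'\<close> of \<open>\<psi>\<close> and \<open>\<alpha> \<otimes> \<beta>\<close>.\<close>

abbreviation post_tensor ::
    "('o, 'm) semimonoidal \<Rightarrow> 'o \<Rightarrow> 'o \<Rightarrow> 'o \<Rightarrow> 'o \<Rightarrow> 'o \<Rightarrow> 'm \<Rightarrow> 'm \<Rightarrow> 'm \<Rightarrow> 'm" where
  "post_tensor P L a a' b b' \<alpha> \<beta> \<psi> \<equiv>
     Comp P L (tob P a b) (tob P a' b') (tmor P a a' b b' \<alpha> \<beta>) \<psi>"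

text \<open>In a cut structure the maps indexed by \<open>L, a, b\<close> are written \<open>c1 L a b\<close>, \<open>c2 L a b\<close>,
  \<open>\<Theta> L a b\<close>.\<close>

definition cut_N ::
    "('o, 'm) semimonoidal \<Rightarrow> ('o \<Rightarrow> 'm) \<Rightarrow> ('o \<Rightarrow> 'o \<Rightarrow> 'o \<Rightarrow> 'm \<Rightarrow> 'm) \<Rightarrow>
     ('o \<Rightarrow> 'o \<Rightarrow> 'o \<Rightarrow> 'm \<Rightarrow> 'm) \<Rightarrow> 'o \<Rightarrow> 'o \<Rightarrow> 'o \<Rightarrow> 'm \<Rightarrow> 'm" where
  "cut_N P \<delta> c1 c2 L a b \<psi> = post_tensor P L L a L b (c1 L a b \<psi>) (c2 L a b \<psi>) (\<delta> L)"

locale cut_structure =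
  fixes P :: "('o, 'm) semimonoidal" and \<delta> :: "'o \<Rightarrow> 'm"
    and c1 c2 :: "'o \<Rightarrow> 'o \<Rightarrow> 'o \<Rightarrow> 'm \<Rightarrow> 'm"
    and \<Theta> :: "'o \<Rightarrow> 'o \<Rightarrow> 'o \<Rightarrow> real \<Rightarrow> 'm \<Rightarrow> 'm"
  assumes \<delta>_mor: "L \<in> Ob P \<Longrightarrow> \<delta> L \<in> mor P L (tob P L L)"
    and c1_continuous: "\<lbrakk>L \<in> Ob P; a \<in> Ob P; b \<in> Ob P\<rbrakk> \<Longrightarrow>
        continuous_map (Hom P L (tob P a b)) (Hom P L a) (c1 L a b)"
    and c2_continuous: "\<lbrakk>L \<in> Ob P; a \<in> Ob P; b \<in> Ob P\<rbrakk> \<Longrightarrow>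
        continuous_map (Hom P L (tob P a b)) (Hom P L b) (c2 L a b)"
    and c1_equivariant: "\<lbrakk>L \<in> Ob P; a \<in> Ob P; a' \<in> Ob P; b \<in> Ob P; b' \<in> Ob P;
          \<alpha> \<in> mor P a a'; \<beta> \<in> mor P b b'; \<psi> \<in> mor P L (tob P a b)\<rbrakk> \<Longrightarrow>
        c1 L a' b' (post_tensor P L a a' b b' \<alpha> \<beta> \<psi>) = Comp P L a a' \<alpha> (c1 L a b \<psi>)"
    and c2_equivariant: "\<lbrakk>L \<in> Ob P; a \<in> Ob P; a' \<in> Ob P; b \<in> Ob P; b' \<in> Ob P;
          \<alpha> \<in> mor P a a'; \<beta> \<in> mor P b b'; \<psi> \<in> mor P L (tob P a b)\<rbrakk> \<Longrightarrow>
        c2 L a' b' (post_tensor P L a a' b b' \<alpha> \<beta> \<psi>) = Comp P L b b' \<beta> (c2 L a b \<psi>)"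
    and \<Theta>_continuous: "\<lbrakk>L \<in> Ob P; a \<in> Ob P; b \<in> Ob P\<rbrakk> \<Longrightarrow>
        continuous_map (Top_prod (top_of_set {0..1}) (Hom P L (tob P a b))) (Hom P L (tob P a b))
          (\<lambda>(u, \<psi>). \<Theta> L a b u \<psi>)"
    and \<Theta>_0: "\<lbrakk>L \<in> Ob P; a \<in> Ob P; b \<in> Ob P; \<psi> \<in> mor P L (tob P a b)\<rbrakk> \<Longrightarrow> \<Theta> L a b 0 \<psi> = \<psi>"
    and \<Theta>_1: "\<lbrakk>L \<in> Ob P; a \<in> Ob P; b \<in> Ob P; \<psi> \<in> mor P L (tob P a b)\<rbrakk> \<Longrightarrow>
        \<Theta> L a b 1 \<psi> = cut_N P \<delta> c1 c2 L a b \<psi>"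
    and \<Theta>_equivariant: "\<lbrakk>L \<in> Ob P; a \<in> Ob P; a' \<in> Ob P; b \<in> Ob P; b' \<in> Ob P; u \<in> {0..1};
          \<alpha> \<in> mor P a a'; \<beta> \<in> mor P b b'; \<psi> \<in> mor P L (tob P a b)\<rbrakk> \<Longrightarrow>
        \<Theta> L a' b' u (post_tensor P L a a' b b' \<alpha> \<beta> \<psi>) =
        post_tensor P L a a' b b' \<alpha> \<beta> (\<Theta> L a b u \<psi>)"


section \<open>P-spaces and their tensor product\<close>

text \<open>\<open>Act D a b \<phi> : D(b) \<rightarrow> D(a)\<close> is the value of the contravariant functor D on \<open>\<phi> : a \<rightarrow> b\<close>.\<close>

record ('o, 'm, 'x) pspace =
  Spc :: "'o \<Rightarrow> 'x topology"
  Act :: "'o \<Rightarrow> 'o \<Rightarrow> 'm \<Rightarrow> 'x \<Rightarrow> 'x"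

locale P_space =
  fixes T :: top_kind and P :: "('o, 'm) semimonoidal" and D :: "('o, 'm, 'x) pspace"
  assumes Spc_in_Top: "a \<in> Ob P \<Longrightarrow> in_Top T (Spc D a)"
    and Act_continuous: "\<lbrakk>a \<in> Ob P; b \<in> Ob P\<rbrakk> \<Longrightarrow>
        continuous_map (Hom P a b) (Top_map (Spc D b) (Spc D a))
          (\<lambda>\<phi>. restrict (Act D a b \<phi>) (topspace (Spc D b)))"
    and Act_Idn: "\<lbrakk>a \<in> Ob P; x \<in> topspace (Spc D a)\<rbrakk> \<Longrightarrow> Act D a a (Idn P a) x = x"
    and Act_Comp: "\<lbrakk>a \<in> Ob P; b \<in> Ob P; c \<in> Ob P; f \<in> mor P a b; g \<in> mor P b c;
          x \<in> topspace (Spc D c)\<rbrakk> \<Longrightarrow>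
        Act D a c (Comp P a b c g f) x = Act D a b f (Act D b c g x)"

locale P_space_map =
  fixes P :: "('o, 'm) semimonoidal" and D :: "('o, 'm, 'x) pspace" and D' :: "('o, 'm, 'y) pspace"
    and f :: "'o \<Rightarrow> 'x \<Rightarrow> 'y"
  assumes component_continuous: "a \<in> Ob P \<Longrightarrow> continuous_map (Spc D a) (Spc D' a) (f a)"
    and naturality: "\<lbrakk>a \<in> Ob P; b \<in> Ob P; \<phi> \<in> mor P a b; x \<in> topspace (Spc D b)\<rbrakk> \<Longrightarrow>
        f a (Act D a b \<phi> x) = Act D' a b \<phi> (f b x)"

text \<open>Triples \<open>(\<psi>, x, y)\<close> in the summand indexed by \<open>(a, b)\<close> are encoded as
  \<open>((a, b), (\<psi>, x, y))\<close>.\<close>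

type_synonym ('o, 'm, 'x, 'y) triple = "('o \<times> 'o) \<times> ('m \<times> 'x \<times> 'y)"

definition tensor_sum :: "('o, 'm) semimonoidal \<Rightarrow> ('o, 'm, 'x) pspace \<Rightarrow> ('o, 'm, 'y) pspace \<Rightarrow>
    'o \<Rightarrow> ('o, 'm, 'x, 'y) triple topology" where
  "tensor_sum P D E L =
     sum_topology (\<lambda>(a, b). Top_prod (Hom P L (tob P a b)) (Top_prod (Spc D a) (Spc E b)))
       (Ob P \<times> Ob P)"

definition tensor_gen :: "('o, 'm) semimonoidal \<Rightarrow> ('o, 'm, 'x) pspace \<Rightarrow> ('o, 'm, 'y) pspace \<Rightarrow>
    'o \<Rightarrow> (('o, 'm, 'x, 'y) triple \<times> ('o, 'm, 'x, 'y) triple) set" where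
  "tensor_gen P D E L =
     {(((a', b'), (post_tensor P L a a' b b' \<alpha> \<beta> \<psi>, x', y')),
       ((a, b), (\<psi>, Act D a a' \<alpha> x', Act E b b' \<beta> y'))) |a a' b b' \<alpha> \<beta> \<psi> x' y'.
        a \<in> Ob P \<and> a' \<in> Ob P \<and> b \<in> Ob P \<and> b' \<in> Ob P \<and>
        \<alpha> \<in> mor P a a' \<and> \<beta> \<in> mor P b b' \<and> \<psi> \<in> mor P L (tob P a b) \<and>
        x' \<in> topspace (Spc D a') \<and> y' \<in> topspace (Spc E b')}"

definition tensor_equiv :: "top_kind \<Rightarrow> ('o, 'm) semimonoidal \<Rightarrow> ('o, 'm, 'x) pspace \<Rightarrow>
    ('o, 'm, 'y) pspace \<Rightarrow> 'o \<Rightarrow> (('o, 'm, 'x, 'y) triple \<times> ('o, 'm, 'x, 'y) triple) set" where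
  "tensor_equiv T P D E L = Top_equiv T (tensor_sum P D E L) (tensor_gen P D E L)"

definition tclass :: "top_kind \<Rightarrow> ('o, 'm) semimonoidal \<Rightarrow> ('o, 'm, 'x) pspace \<Rightarrow>
    ('o, 'm, 'y) pspace \<Rightarrow> 'o \<Rightarrow> 'o \<Rightarrow> 'o \<Rightarrow> 'm \<Rightarrow> 'x \<Rightarrow> 'y \<Rightarrow> ('o, 'm, 'x, 'y) triple set" where
  "tclass T P D E L a b \<psi> x y = tensor_equiv T P D E L `` {((a, b), (\<psi>, x, y))}"

text \<open>Maps out of the tensor product are given by formulas on representatives. For a map into
  another tensor product, the value on a class C is the saturation of the image of C, which is a
  single class whenever the formula is compatible with the relations.\<close>

definition tensor :: "top_kind \<Rightarrow> ('o, 'm) semimonoidal \<Rightarrow> ('o, 'm, 'x) pspace \<Rightarrow>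
    ('o, 'm, 'y) pspace \<Rightarrow> ('o, 'm, ('o, 'm, 'x, 'y) triple set) pspace" where
  "tensor T P D E =
     \<lparr>Spc = (\<lambda>L. Top_quotient T (tensor_sum P D E L) (tensor_gen P D E L)),
      Act = (\<lambda>L L' \<theta> C. tensor_equiv T P D E L ``
               ((\<lambda>((a, b), (\<psi>, x, y)). ((a, b), (Comp P L L' (tob P a b) \<psi> \<theta>, x, y))) ` C))\<rparr>"

definition tensor_map :: "top_kind \<Rightarrow> ('o, 'm) semimonoidal \<Rightarrow> ('o, 'm, 'x2) pspace \<Rightarrow>
    ('o, 'm, 'y2) pspace \<Rightarrow> ('o \<Rightarrow> 'x \<Rightarrow> 'x2) \<Rightarrow> ('o \<Rightarrow> 'y \<Rightarrow> 'y2) \<Rightarrow> 'o \<Rightarrow>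
    ('o, 'm, 'x, 'y) triple set \<Rightarrow> ('o, 'm, 'x2, 'y2) triple set" where
  "tensor_map T P D' E' f g L C = tensor_equiv T P D' E' L ``
     ((\<lambda>((a, b), (\<psi>, x, y)). ((a, b), (\<psi>, f a x, g b y))) ` C)"

text \<open>\<open>the_elem\<close> picks the common value of the formula on all representatives of the class C.\<close>

definition r_map :: "('o \<Rightarrow> 'o \<Rightarrow> 'o \<Rightarrow> 'm \<Rightarrow> 'm) \<Rightarrow> ('o \<Rightarrow> 'o \<Rightarrow> 'o \<Rightarrow> 'm \<Rightarrow> 'm) \<Rightarrow>
    ('o, 'm, 'x) pspace \<Rightarrow> ('o, 'm, 'y) pspace \<Rightarrow> 'o \<Rightarrow> ('o, 'm, 'x, 'y) triple set \<Rightarrow> 'x \<times> 'y" where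
  "r_map c1 c2 D E L C = the_elem
     ((\<lambda>((a, b), (\<psi>, x, y)). (Act D L a (c1 L a b \<psi>) x, Act E L b (c2 L a b \<psi>) y)) ` C)"

definition s_map :: "top_kind \<Rightarrow> ('o, 'm) semimonoidal \<Rightarrow> ('o \<Rightarrow> 'm) \<Rightarrow>
    ('o, 'm, 'x) pspace \<Rightarrow> ('o, 'm, 'y) pspace \<Rightarrow> 'o \<Rightarrow> 'x \<times> 'y \<Rightarrow> ('o, 'm, 'x, 'y) triple set" where
  "s_map T P \<delta> D E L = (\<lambda>(x, y). tclass T P D E L L L (\<delta> L) x y)"

text \<open>The library's homotopies are defined on the ordinary product with the unit interval. For a
  Delta-generated space this is the product in Top, since the interval is locally compact.\<close>

definition homotopy_inverses :: "'a topology \<Rightarrow> 'b topology \<Rightarrow> ('a \<Rightarrow> 'b) \<Rightarrow> ('b \<Rightarrow> 'a) \<Rightarrow> bool" where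
  "homotopy_inverses X Y f g \<longleftrightarrow>
     continuous_map X Y f \<and> continuous_map Y X g \<and>
     homotopic_with (\<lambda>_. True) X X (g \<circ> f) id \<and> homotopic_with (\<lambda>_. True) Y Y (f \<circ> g) id"

end

theory Submission
  imports Defs
begin

text \<open>The theorem is a computation in the coend together with some point-set topology.

  The computation: the homotopy \<open>\<Theta>\<close> moves \<open>\<psi> : L \<rightarrow> a \<otimes> b\<close> to \<open>(c1 \<psi> \<otimes> c2 \<psi>) \<delta>\<close>, and the coend relation
  carries the factors \<open>c1 \<psi>\<close> and \<open>c2 \<psi>\<close> over to the other two coordinates, so that
  \<open>[(c1 \<psi> \<otimes> c2 \<psi>) \<delta>, x, y] = [\<delta>, D(c1 \<psi>) x, E(c2 \<psi>) y] = s (r [\<psi>, x, y])\<close>. Equivariance of \<open>\<Theta>\<close> gives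
  that \<open>[\<psi>, x, y] \<mapsto> [\<Theta>(u, \<psi>), x, y]\<close> respects the coend relation for each \<open>u\<close>; this is the homotopy
  from the identity to \<open>s \<circ> r\<close> (lemma \<open>s_r_homotopic_id\<close>). In the other order, \<open>r \<circ> s\<close> acts on the two
  factors by the endomorphisms \<open>c1 \<delta>\<close> and \<open>c2 \<delta>\<close> of \<open>L\<close>. The space of endomorphisms of \<open>L\<close> is
  contractible, hence both are joined to the identity by paths, along which \<open>D\<close> and \<open>E\<close> act
  (lemma \<open>r_s_homotopic_id\<close>).

  Three topological facts make these formulas continuous maps.
  Actions are given as continuous maps into mapping spaces, and evaluation turns them into jointly
  continuous maps on products (lemma \<open>continuous_map_Top_map_evaluation\<close>).
  Homotopies live on the ordinary product with the unit interval, whereas \<open>\<Theta>\<close> is continuous on the product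
  in Top; the two agree because the product of the interval with a Delta-generated space is
  Delta-generated (lemma \<open>delta_generated_interval_prod\<close>).
  Finally, the coend is a quotient by an intersection of relations. That intersection is itself
  among the relations intersected, and a map into an object of Top that respects the generators is constant on
  its classes (lemmas \<open>in_Top_Top_quotient\<close> and \<open>Top_equiv_respects\<close>). For the
  Delta-Hausdorff meaning of Top this rests on the fact that continuous maps into a Delta-Hausdorff space
  coincide with a path on a closed set (lemma \<open>closedin_coincidence_with_path\<close>).\<close>

section \<open>Delta-generated spaces\<close>

abbreviation unit_interval :: "real topology" where
  "unit_interval \<equiv> top_of_set {0..1}"

lemma openin_imp_delta_open: "openin X U \<Longrightarrow> delta_open X U"
  unfolding delta_open_def
  using openin_continuous_map_preimage openin_subset by blast

lemma topspace_delta_kelley [simp]: "topspace (delta_kelley X) = topspace X"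
proof
  show "topspace (delta_kelley X) \<subseteq> topspace X"
    using openin_topspace[of "delta_kelley X"] by (simp add: openin_delta_kelley delta_open_def)
  show "topspace X \<subseteq> topspace (delta_kelley X)"
    by (simp add: openin_subset openin_delta_kelley openin_imp_delta_open)
qed

lemma continuous_map_from_delta_kelley:
  "continuous_map X Y f \<Longrightarrow> continuous_map (delta_kelley X) Y f"
  by (simp add: continuous_map_def openin_delta_kelley openin_imp_delta_open)

lemma delta_open_preimage:
  assumes f: "continuous_map W X f" and U: "delta_open X U"
  shows "delta_open W {w \<in> topspace W. f w \<in> U}"
  unfolding delta_open_def
proof (intro conjI allI impI)
  fix n \<sigma> assume \<sigma>: "continuous_map (simplex_space n) W \<sigma>"
  have "openin (simplex_space n) {t \<in> topspace (simplex_space n). (f \<circ> \<sigma>) t \<in> U}"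
    using U continuous_map_compose[OF \<sigma> f] unfolding delta_open_def by blast
  moreover have "{t \<in> topspace (simplex_space n). (f \<circ> \<sigma>) t \<in> U} =
      {t \<in> topspace (simplex_space n). \<sigma> t \<in> {w \<in> topspace W. f w \<in> U}}"
    using continuous_map_funspace[OF \<sigma>] by auto
  ultimately show "openin (simplex_space n)
      {t \<in> topspace (simplex_space n). \<sigma> t \<in> {w \<in> topspace W. f w \<in> U}}" by metis
qed auto

text \<open>The universal property of the coreflection; through it, a pair of continuous maps is continuous into the product in Top.\<close>

lemma continuous_map_into_delta_kelley:
  assumes "delta_generated W" and f: "continuous_map W X f"
  shows "continuous_map W (delta_kelley X) f"
  using assms delta_open_preimage[OF f] unfolding continuous_map_def
  by (simp add: openin_delta_kelley delta_generated_def)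

lemma delta_generated_simplex_space: "delta_generated (simplex_space n)"
  unfolding delta_generated_def
proof (intro allI impI)
  fix U assume U: "delta_open (simplex_space n) U"
  have "continuous_map (simplex_space n) (simplex_space n) (\<lambda>t. t)"
    by (simp add: continuous_map_id[unfolded id_def])
  with U have "openin (simplex_space n) {t \<in> topspace (simplex_space n). t \<in> U}"
    unfolding delta_open_def by blast
  moreover have "{t \<in> topspace (simplex_space n). t \<in> U} = U"
    using U unfolding delta_open_def by blast
  ultimately show "openin (simplex_space n) U" by metis
qed

lemma delta_generated_delta_kelley: "delta_generated (delta_kelley X)"
  using continuous_map_into_delta_kelley[OF delta_generated_simplex_space, of _ X]
  by (auto simp: delta_generated_def openin_delta_kelley delta_open_def)

lemma continuous_map_from_delta_generated:
  assumes W: "delta_generated W" and f: "f \<in> topspace W \<rightarrow> topspace Y"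
    and \<sigma>: "\<And>n \<sigma>. continuous_map (simplex_space n) W \<sigma> \<Longrightarrow>
               continuous_map (simplex_space n) Y (f \<circ> \<sigma>)"
  shows "continuous_map W Y f"
  unfolding continuous_map_def
proof (intro conjI allI impI)
  fix U assume U: "openin Y U"
  have "delta_open W {x \<in> topspace W. f x \<in> U}"
    unfolding delta_open_def
  proof (intro conjI allI impI)
    fix n \<tau> assume \<tau>: "continuous_map (simplex_space n) W \<tau>"
    have "openin (simplex_space n) {t \<in> topspace (simplex_space n). (f \<circ> \<tau>) t \<in> U}"
      using \<sigma>[OF \<tau>] U openin_continuous_map_preimage by blast
    moreover have "{t \<in> topspace (simplex_space n). (f \<circ> \<tau>) t \<in> U} =
        {t \<in> topspace (simplex_space n). \<tau> t \<in> {x \<in> topspace W. f x \<in> U}}"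
      using continuous_map_funspace[OF \<tau>] by auto
    ultimately show "openin (simplex_space n)
        {t \<in> topspace (simplex_space n). \<tau> t \<in> {x \<in> topspace W. f x \<in> U}}" by metis
  qed auto
  then show "openin W {x \<in> topspace W. f x \<in> U}"
    using W unfolding delta_generated_def by blast
qed (rule f)

lemma delta_generated_quotient_map_image:
  assumes q: "quotient_map X Y q" and X: "delta_generated X"
  shows "delta_generated Y"
  unfolding delta_generated_def
proof (intro allI impI)
  fix U assume U: "delta_open Y U"
  then have "openin X {x \<in> topspace X. q x \<in> U}"
    using X delta_open_preimage[OF quotient_imp_continuous_map[OF q]]
    unfolding delta_generated_def by blast
  with U q show "openin Y U"
    unfolding quotient_map_def delta_open_def by blast
qed

lemma delta_generated_sum_topology:
  assumes "\<And>i. i \<in> I \<Longrightarrow> delta_generated (X i)"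
  shows "delta_generated (sum_topology X I)"
  unfolding delta_generated_def
proof (intro allI impI)
  fix U assume U: "delta_open (sum_topology X I) U"
  then have sub: "U \<subseteq> Sigma I (topspace \<circ> X)"
    unfolding delta_open_def by simp
  have "openin (X i) {x. (i, x) \<in> U}" if i: "i \<in> I" for i
  proof -
    have "openin (X i) {x \<in> topspace (X i). (i, x) \<in> U}"
      using delta_open_preimage[OF continuous_map_component_injection[OF i] U] assms[OF i]
      unfolding delta_generated_def by blast
    moreover have "{x \<in> topspace (X i). (i, x) \<in> U} = {x. (i, x) \<in> U}"
      using sub by auto
    ultimately show ?thesis by metis
  qed
  with sub show "openin (sum_topology X I) U"
    by (simp add: openin_sum_topology)
qed

lemma topspace_Top_prod [simp]: "topspace (Top_prod X Y) = topspace X \<times> topspace Y"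
  by (simp add: Top_prod_def)

lemma delta_generated_Top_prod: "delta_generated (Top_prod X Y)"
  by (simp add: Top_prod_def delta_generated_delta_kelley)

lemma continuous_map_Top_prod_fst: "continuous_map (Top_prod X Y) X fst"
  and continuous_map_Top_prod_snd: "continuous_map (Top_prod X Y) Y snd"
  unfolding Top_prod_def
  by (simp_all add: continuous_map_from_delta_kelley continuous_map_fst continuous_map_snd)

lemma continuous_map_into_Top_prod:
  assumes "delta_generated W" "continuous_map W X f" "continuous_map W Y g"
  shows "continuous_map W (Top_prod X Y) (\<lambda>w. (f w, g w))"
  unfolding Top_prod_def
  using assms by (intro continuous_map_into_delta_kelley) (simp_all add: continuous_map_pairedI)

section \<open>The product of the unit interval with a Delta-generated space\<close>

lemma delta_generated_retraction:
  assumes A: "delta_generated A" and r: "continuous_map A B r" and s: "continuous_map B A s"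
    and rs: "\<And>b. b \<in> topspace B \<Longrightarrow> r (s b) = b"
  shows "delta_generated B"
proof (rule delta_generated_quotient_map_image[OF _ A])
  show "quotient_map A B r"
    by (rule retraction_imp_quotient_map)
      (use r s rs in \<open>auto simp: retraction_map_def retraction_maps_def\<close>)
qed

text \<open>The prism \<open>I \<times> \<Delta>\<^sup>n\<close> is a retract of the simplex of dimension \<open>2n + 1\<close>: send the vertices of that simplex
  bijectively to the \<open>2n + 2\<close> vertices of the prism and extend affinely. The section distributes the
  barycentric coordinates of a point at height \<open>u\<close> with weight \<open>1 - u\<close> over the bottom vertices and with weight \<open>u\<close>
  over the top ones.\<close>

lemma delta_generated_interval_prod_simplex:
  "delta_generated (prod_topology unit_interval (simplex_space n))"
proof -
  let ?m = "Suc n + n"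
  \<comment> \<open>The coordinates \<open>0, \<dots>, n\<close> belong to the bottom of the prism and \<open>n + 1, \<dots>, 2n + 1\<close> to the top.\<close>
  define r :: "(nat \<Rightarrow> real) \<Rightarrow> real \<times> (nat \<Rightarrow> real)" where
    "r t = (\<Sum>i\<le>n. t (Suc n + i), \<lambda>i. if i \<le> n then t i + t (Suc n + i) else 0)" for t
  define s :: "real \<times> (nat \<Rightarrow> real) \<Rightarrow> nat \<Rightarrow> real" where
    "s z j = (if j \<le> n then (1 - fst z) * snd z j else fst z * snd z (j - Suc n))" for z j
  have split: "(\<Sum>j\<le>?m. f j) = (\<Sum>i\<le>n. f i) + (\<Sum>i\<le>n. f (Suc n + i))" for f :: "nat \<Rightarrow> real"
  proof -
    have "(\<Sum>j\<le>?m. f j) = (\<Sum>i\<le>n. f i) + (\<Sum>i=Suc n..Suc n+n. f i)"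
      using sum_up_index_split[of f n "Suc n"] by (simp add: add.commute)
    also have "(\<Sum>i=Suc n..Suc n+n. f i) = (\<Sum>i=0..n. f (Suc n + i))"
      using sum.shift_bounds_cl_nat_ivl[of f 0 "Suc n" n] by (simp add: add.commute)
    finally show ?thesis by (simp add: atMost_atLeast0)
  qed
  have proj: "continuous_map (simplex_space k) euclideanreal (\<lambda>t. t i)" for k i
    by (intro continuous_map_from_subtopology continuous_map_product_projection) simp
  show ?thesis
  proof (rule delta_generated_retraction[OF delta_generated_simplex_space])
    have "r t \<in> {0..1} \<times> standard_simplex n" if "t \<in> standard_simplex ?m" for t
    proof -
      have t: "\<And>i. 0 \<le> t i" "(\<Sum>i\<le>n. t i) + (\<Sum>i\<le>n. t (Suc n + i)) = 1"
        using that split[of t] by (auto simp: standard_simplex_def)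
      then have "0 \<le> (\<Sum>i\<le>n. t i)" "0 \<le> (\<Sum>i\<le>n. t (Suc n + i))"
        by (simp_all add: sum_nonneg)
      moreover have "t i + t (Suc n + i) \<le> 1" if "i \<le> n" for i
      proof -
        have "t i + t (Suc n + i) \<le> (\<Sum>i\<le>n. t i + t (Suc n + i))"
          by (rule member_le_sum[where f="\<lambda>i. t i + t (Suc n + i)"]) (use t that in auto)
        with t show ?thesis by (simp add: sum.distrib)
      qed
      ultimately show ?thesis
        using t by (auto simp: r_def standard_simplex_def sum.distrib)
    qed
    moreover have "continuous_map (simplex_space ?m) euclideanreal
        (\<lambda>t. if i \<le> n then t i + t (Suc n + i) else 0)" for i
      by (cases "i \<le> n") (auto intro!: continuous_map_add proj)
    ultimately show "continuous_map (simplex_space ?m) (prod_topology unit_interval (simplex_space n)) r"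
      by (auto simp: continuous_map_pairwise continuous_map_in_subtopology o_def r_def
          continuous_map_componentwise_UNIV intro!: continuous_map_sum proj)
    have "s z \<in> standard_simplex ?m" if zI: "z \<in> {0..1} \<times> standard_simplex n" for z
    proof -
      obtain u p where z: "z = (u, p)" "0 \<le> u" "u \<le> 1" "p \<in> standard_simplex n"
        using zI by (metis mem_Times_iff prod.collapse atLeastAtMost_iff)
      then have p: "\<And>i. 0 \<le> p i" "\<And>i. p i \<le> 1" "\<And>i. i > n \<Longrightarrow> p i = 0" "(\<Sum>i\<le>n. p i) = 1"
        by (auto simp: standard_simplex_def)
      have "sum (s z) {..?m} = 1"
        unfolding split using p z by (simp add: s_def flip: sum_distrib_left)
      moreover have "0 \<le> s z i" "s z i \<le> 1" for i
        using p z by (auto simp: s_def intro!: mult_nonneg_nonneg mult_le_one)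
      moreover have "s z i = 0" if "i > ?m" for i
        using p z that by (auto simp: s_def)
      ultimately show ?thesis by (auto simp: standard_simplex_def)
    qed
    moreover have "continuous_map (prod_topology unit_interval (simplex_space n)) euclideanreal (\<lambda>z. s z j)" for j
    proof -
      have 1: "continuous_map (prod_topology unit_interval (simplex_space n)) euclideanreal fst"
        using continuous_map_fst continuous_map_in_subtopology by blast
      have 2: "continuous_map (prod_topology unit_interval (simplex_space n)) euclideanreal (\<lambda>z. snd z i)" for i
        using continuous_map_compose[OF continuous_map_snd proj] by (simp add: o_def)
      show ?thesis
        by (cases "j \<le> n") (auto simp: s_def intro!: continuous_map_real_mult continuous_map_diff 1 2)
    qed
    ultimately show "continuous_map (prod_topology unit_interval (simplex_space n)) (simplex_space ?m) s"
      by (auto simp: continuous_map_in_subtopology continuous_map_componentwise_UNIV)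
    show "r (s z) = z" if zI: "z \<in> topspace (prod_topology unit_interval (simplex_space n))" for z
    proof -
      obtain u p where z: "z = (u, p)" "p \<in> standard_simplex n"
        using zI by (metis mem_Times_iff prod.collapse topspace_prod_topology topspace_standard_simplex)
      then have "\<And>i. i > n \<Longrightarrow> p i = 0" "(\<Sum>i\<le>n. p i) = 1"
        by (auto simp: standard_simplex_def)
      with z show ?thesis
        by (auto simp: r_def s_def fun_eq_iff algebra_simps simp flip: sum_distrib_left)
    qed
  qed
qed

text \<open>A set that is open along all simplices of \<open>I \<times> X\<close> pulls back to an open set of \<open>I \<times> \<Delta>\<^sup>n\<close> along \<open>id \<times> \<sigma>\<close> for
  every simplex \<open>\<sigma>\<close> of \<open>X\<close>, by the preceding lemma. Compact subintervals and the tube lemma then produce a product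
  neighbourhood of each of its points.\<close>

lemma delta_generated_interval_prod:
  assumes X: "delta_generated X"
  shows "delta_generated (prod_topology unit_interval X)"
  unfolding delta_generated_def
proof (intro allI impI)
  fix U assume U: "delta_open (prod_topology unit_interval X) U"
  then have Usub: "U \<subseteq> {0..1} \<times> topspace X"
    unfolding delta_open_def by simp
  have slice: "openin (prod_topology unit_interval (simplex_space n))
      {z \<in> {0..1} \<times> standard_simplex n. (fst z, \<sigma> (snd z)) \<in> U}"
    if \<sigma>: "continuous_map (simplex_space n) X \<sigma>" for n \<sigma>
  proof -
    have "continuous_map (prod_topology unit_interval (simplex_space n)) (prod_topology unit_interval X)
        (\<lambda>z. (fst z, \<sigma> (snd z)))"
      using continuous_map_compose[OF continuous_map_snd \<sigma>]
      by (intro continuous_map_pairedI continuous_map_fst) (simp add: o_def)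
    from delta_open_preimage[OF this U] show ?thesis
      using delta_generated_interval_prod_simplex[of n] unfolding delta_generated_def by simp
  qed
  show "openin (prod_topology unit_interval X) U"
    unfolding openin_prod_topology_alt
  proof (intro allI impI)
    fix u x assume ux: "(u, x) \<in> U"
    then have u: "u \<in> {0..1}" and x: "x \<in> topspace X" using Usub by auto
    \<comment> \<open>The slice of \<open>U\<close> over \<open>x\<close> is seen by the constant simplex of dimension zero at \<open>x\<close>.\<close>
    obtain V where V: "openin unit_interval V" "u \<in> V" "\<forall>v\<in>V. (v, x) \<in> U"
    proof -
      obtain p :: "nat \<Rightarrow> real" where p: "p \<in> standard_simplex 0" using nonempty_standard_simplex by blast
      have "continuous_map (simplex_space 0) X (\<lambda>_. x)" using x by simp
      from slice[OF this]
      have "\<exists>V W. openin unit_interval V \<and> openin (simplex_space 0) W \<and> u \<in> V \<and> p \<in> W \<and>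
          V \<times> W \<subseteq> {z \<in> {0..1} \<times> standard_simplex 0. (fst z, x) \<in> U}"
        unfolding openin_prod_topology_alt using p u ux by auto
      then obtain V W where V: "openin unit_interval V" "u \<in> V" "p \<in> W"
        and VW: "V \<times> W \<subseteq> {z \<in> {0..1} \<times> standard_simplex 0. (fst z, x) \<in> U}" by blast
      have "\<forall>v\<in>V. (v, x) \<in> U" using VW \<open>p \<in> W\<close> by auto
      with V that show thesis by blast
    qed
    obtain e where e: "e > 0" "ball u e \<inter> {0..1} \<subseteq> V"
      using V by (meson openin_contains_ball)
    define J where "J = cball u (e/2) \<inter> {0..1}"
    have J: "compactin unit_interval J" "\<forall>v\<in>J. (v, x) \<in> U" "J \<subseteq> {0..1}"
      using e V(3) by (force simp: J_def compactin_subtopology compact_Int)+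
    define B where "B = {y \<in> topspace X. \<forall>v\<in>J. (v, y) \<in> U}"
    have "delta_open X B"
      unfolding delta_open_def
    proof (intro conjI allI impI)
      fix n \<sigma> assume \<sigma>: "continuous_map (simplex_space n) X \<sigma>"
      let ?O = "{z \<in> {0..1} \<times> standard_simplex n. (fst z, \<sigma> (snd z)) \<in> U}"
      have eq: "{t \<in> topspace (simplex_space n). \<sigma> t \<in> B} = {t \<in> standard_simplex n. J \<times> {t} \<subseteq> ?O}"
        using continuous_map_funspace[OF \<sigma>] J by (auto simp: B_def)
      show "openin (simplex_space n) {t \<in> topspace (simplex_space n). \<sigma> t \<in> B}"
        unfolding eq
      proof (subst openin_subopen, intro ballI)
        fix t assume t: "t \<in> {t \<in> standard_simplex n. J \<times> {t} \<subseteq> ?O}"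
        then obtain V' W where "openin unit_interval V'" and W: "openin (simplex_space n) W" "t \<in> W"
            and VW: "J \<subseteq> V'" "V' \<times> W \<subseteq> ?O"
          using tube_lemma_left[OF slice[OF \<sigma>] J(1), of t] by auto
        have "W \<subseteq> standard_simplex n" using openin_subset[OF W(1)] by simp
        then have "W \<subseteq> {t \<in> standard_simplex n. J \<times> {t} \<subseteq> ?O}" using VW by blast
        with W show "\<exists>S. openin (simplex_space n) S \<and> t \<in> S \<and> S \<subseteq> {t \<in> standard_simplex n. J \<times> {t} \<subseteq> ?O}"
          by blast
      qed
    qed (simp add: B_def)
    then have "openin X B" using X unfolding delta_generated_def by blast
    moreover have "openin unit_interval (ball u (e/2) \<inter> {0..1})"
      by (metis Int_commute open_ball openin_open_Int)
    moreover have "u \<in> ball u (e/2) \<inter> {0..1}" "x \<in> B" using e u x J by (auto simp: B_def)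
    moreover have "(ball u (e/2) \<inter> {0..1}) \<times> B \<subseteq> U"
      by (auto simp: B_def J_def)
    ultimately show "\<exists>V W. openin unit_interval V \<and> openin X W \<and> u \<in> V \<and> x \<in> W \<and> V \<times> W \<subseteq> U"
      by blast
  qed
qed

section \<open>Delta-Hausdorff spaces\<close>

lemma singleton_closed_if_delta_Hausdorff:
  assumes Y: "delta_Hausdorff Y" and y: "y \<in> topspace Y"
  shows "closedin Y {y}"
proof -
  have "pathin Y (\<lambda>_. y)" using y by (simp add: pathin_def)
  with Y have "closedin Y ((\<lambda>_. y) ` {0..1::real})" unfolding delta_Hausdorff_def by blast
  then show ?thesis by (simp add: image_constant_conv)
qed

lemma closedin_path_subinterval:
  assumes Y: "delta_Hausdorff Y" and \<beta>: "pathin Y \<beta>" and lr: "0 \<le> l" "l \<le> r" "r \<le> 1"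
  shows "closedin Y (\<beta> ` {l..r})"
proof -
  have eq: "(\<lambda>s. l + s * (r - l)) ` {0..1} = {l..r}"
  proof (intro subset_antisym subsetI)
    fix v assume "v \<in> (\<lambda>s. l + s * (r - l)) ` {0..1}"
    then obtain s where "v = l + s * (r - l)" "s \<in> {0..1}" by blast
    then show "v \<in> {l..r}"
      using lr mult_left_le_one_le[of "r - l" s] by auto
  next
    fix v assume v: "v \<in> {l..r}"
    show "v \<in> (\<lambda>s. l + s * (r - l)) ` {0..1}"
    proof (cases "l = r")
      case False
      then show ?thesis
        using v by (intro image_eqI[of _ _ "(v - l) / (r - l)"]) (auto simp: field_simps)
    qed (use v in \<open>auto intro: image_eqI[of _ _ 0]\<close>)
  qed
  have "pathin Y (\<beta> \<circ> (\<lambda>s. l + s * (r - l)))"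
    unfolding pathin_def
  proof (rule continuous_map_compose)
    have "continuous_on {0..1} (\<lambda>s. l + s * (r - l))" by (intro continuous_intros)
    moreover have "(\<lambda>s. l + s * (r - l)) ` {0..1} \<subseteq> {0..1}" unfolding eq using lr by auto
    ultimately show "continuous_map unit_interval unit_interval (\<lambda>s. l + s * (r - l))"
      by (simp add: continuous_map_in_subtopology image_subset_iff_funcset)
    show "continuous_map unit_interval Y \<beta>" using \<beta> by (simp add: pathin_def)
  qed
  then have "closedin Y ((\<beta> \<circ> (\<lambda>s. l + s * (r - l))) ` {0..1})"
    using Y unfolding delta_Hausdorff_def by blast
  then show ?thesis unfolding image_comp[symmetric] eq .
qed

text \<open>A substitute for the closed diagonal. If \<open>\<alpha> z \<noteq> \<beta> s\<close>, then \<open>s\<close> has a closed interval \<open>J\<close> as a neighbourhood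
  whose image under \<open>\<beta>\<close> misses \<open>\<alpha> z\<close>, points being closed. As a reparametrized path, \<open>\<beta>\<close> on \<open>J\<close> has closed image, so
  \<open>\<alpha>\<close> stays outside this image near \<open>z\<close>.\<close>

lemma closedin_coincidence_with_path:
  assumes Y: "delta_Hausdorff Y" and \<alpha>: "continuous_map Z Y \<alpha>" and \<beta>: "pathin Y \<beta>"
  shows "closedin (prod_topology Z unit_interval) {z \<in> topspace Z \<times> {0..1}. \<alpha> (fst z) = \<beta> (snd z)}"
proof -
  let ?C = "{z \<in> topspace Z \<times> {0..1}. \<alpha> (fst z) = \<beta> (snd z)}"
  have "openin (prod_topology Z unit_interval) (topspace Z \<times> {0..1} - ?C)"
    unfolding openin_prod_topology_alt
  proof (intro allI impI)
    fix z s assume "(z, s) \<in> topspace Z \<times> {0..1} - ?C"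
    then have z: "z \<in> topspace Z" and s: "s \<in> {0..1}" and ne: "\<alpha> z \<noteq> \<beta> s" by auto
    have \<beta>c: "continuous_map unit_interval Y \<beta>" using \<beta> by (simp add: pathin_def)
    have "\<alpha> z \<in> topspace Y" using \<alpha> z continuous_map_funspace by blast
    then have "openin Y (topspace Y - {\<alpha> z})"
      using singleton_closed_if_delta_Hausdorff[OF Y] by blast
    from openin_continuous_map_preimage[OF \<beta>c this]
    have "openin unit_interval {v \<in> {0..1}. \<beta> v \<in> topspace Y - {\<alpha> z}}" by simp
    moreover have "s \<in> {v \<in> {0..1}. \<beta> v \<in> topspace Y - {\<alpha> z}}"
      using s ne continuous_map_funspace[OF \<beta>c] by auto
    ultimately obtain e where e: "e > 0" "ball s e \<inter> {0..1} \<subseteq> {v \<in> {0..1}. \<beta> v \<in> topspace Y - {\<alpha> z}}"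
      by (meson openin_contains_ball)
    define l r where "l = max 0 (s - e/2)" and "r = min 1 (s + e/2)"
    have lr: "0 \<le> l" "l \<le> r" "r \<le> 1" using s e by (auto simp: l_def r_def)
    have J: "v \<in> ball s e \<inter> {0..1}" if "v \<in> {l..r}" for v
      using that e by (auto simp: l_def r_def dist_real_def)
    define W where "W = {w \<in> topspace Z. \<alpha> w \<in> topspace Y - \<beta> ` {l..r}}"
    have "openin Z W" unfolding W_def
      by (rule openin_continuous_map_preimage[OF \<alpha>])
        (use closedin_path_subinterval[OF Y \<beta> lr] in blast)
    moreover have "openin unit_interval (ball s (e/2) \<inter> {0..1})"
      by (metis Int_commute open_ball openin_open_Int)
    moreover have "\<forall>v\<in>{l..r}. \<beta> v \<noteq> \<alpha> z"
      using J e(2) by blast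
    then have "\<alpha> z \<notin> \<beta> ` {l..r}" by (metis imageE)
    then have "z \<in> W" using z \<open>\<alpha> z \<in> topspace Y\<close> by (auto simp: W_def)
    moreover have "s \<in> ball s (e/2) \<inter> {0..1}" using s e by auto
    moreover have "ball s (e/2) \<inter> {0..1} \<subseteq> {l..r}"
    proof
      fix v assume v: "v \<in> ball s (e/2) \<inter> {0..1}"
      then have "\<bar>s - v\<bar> < e/2" by (simp add: dist_real_def)
      with v show "v \<in> {l..r}" unfolding abs_less_iff l_def r_def by simp
    qed
    then have "W \<times> (ball s (e/2) \<inter> {0..1}) \<subseteq> topspace Z \<times> {0..1} - ?C"
      by (auto simp: W_def)
    ultimately show "\<exists>U V. openin Z U \<and> openin unit_interval V \<and> z \<in> U \<and> s \<in> V \<and>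
        U \<times> V \<subseteq> topspace Z \<times> {0..1} - ?C" by blast
  qed
  then show ?thesis by (auto simp: closedin_def)
qed

text \<open>The image of \<open>\<gamma>\<close> is the projection of its graph along the compact interval, and this projection is a closed map.\<close>

lemma delta_HausdorffI:
  assumes "\<And>\<gamma>. pathin Z \<gamma> \<Longrightarrow>
     closedin (prod_topology Z unit_interval) {z \<in> topspace Z \<times> {0..1}. fst z = \<gamma> (snd z)}"
  shows "delta_Hausdorff Z"
  unfolding delta_Hausdorff_def
proof (intro allI impI)
  fix \<gamma> assume \<gamma>: "pathin Z \<gamma>"
  have "closed_map (prod_topology Z unit_interval) Z fst"
    by (rule closed_map_fst) (simp add: compact_space_subtopology)
  then have "closedin Z (fst ` {z \<in> topspace Z \<times> {0..1}. fst z = \<gamma> (snd z)})"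
    using assms[OF \<gamma>] unfolding closed_map_def by blast
  moreover have "fst ` {z \<in> topspace Z \<times> {0..1}. fst z = \<gamma> (snd z)} = \<gamma> ` {0..1}"
  proof -
    have "{z \<in> topspace Z \<times> {0..1}. fst z = \<gamma> (snd z)} = (\<lambda>s. (\<gamma> s, s)) ` {0..1}"
      using \<gamma> unfolding pathin_def continuous_map_def by auto
    then show ?thesis by (simp add: image_comp o_def)
  qed
  ultimately show "closedin Z (\<gamma> ` {0..1})" by simp
qed

text \<open>The graph of a path in \<open>Z\<close> is the intersection of the coincidence sets obtained from the maps \<open>f i\<close>.\<close>

lemma delta_Hausdorff_jointly_injective:
  fixes Y :: "'i \<Rightarrow> 'b topology"
  assumes Y: "\<And>i. i \<in> I \<Longrightarrow> delta_Hausdorff (Y i)"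
    and f: "\<And>i. i \<in> I \<Longrightarrow> continuous_map Z (Y i) (f i)"
    and inj: "\<And>x y. \<lbrakk>x \<in> topspace Z; y \<in> topspace Z; \<And>i. i \<in> I \<Longrightarrow> f i x = f i y\<rbrakk> \<Longrightarrow> x = y"
  shows "delta_Hausdorff Z"
proof (rule delta_HausdorffI)
  fix \<gamma> assume \<gamma>: "pathin Z \<gamma>"
  let ?C = "\<lambda>i. {z \<in> topspace Z \<times> {0..1}. f i (fst z) = (f i \<circ> \<gamma>) (snd z)}"
  have "closedin (prod_topology Z unit_interval) (?C i)" if "i \<in> I" for i
    using that by (intro closedin_coincidence_with_path[OF Y f] pathin_compose[OF \<gamma>] f)
  moreover have "closedin (prod_topology Z unit_interval) (topspace Z \<times> {0..1})"
    using closedin_topspace[of "prod_topology Z unit_interval"] by simp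
  ultimately have "closedin (prod_topology Z unit_interval) (\<Inter>(insert (topspace Z \<times> {0..1}) (?C ` I)))"
    by (intro closedin_Inter) auto
  moreover have "\<Inter>(insert (topspace Z \<times> {0..1}) (?C ` I)) = {z \<in> topspace Z \<times> {0..1}. fst z = \<gamma> (snd z)}"
  proof -
    have "\<gamma> s \<in> topspace Z" if "s \<in> {0..1}" for s
      using \<gamma> that unfolding pathin_def continuous_map_def by auto
    then have "x = \<gamma> s" if "x \<in> topspace Z" "s \<in> {0..1}" "\<And>i. i \<in> I \<Longrightarrow> f i x = f i (\<gamma> s)" for x s
      using that by (intro inj) auto
    then show ?thesis by auto
  qed
  ultimately show "closedin (prod_topology Z unit_interval) {z \<in> topspace Z \<times> {0..1}. fst z = \<gamma> (snd z)}"
    by metis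
qed

lemma delta_Hausdorff_Top_prod:
  assumes X: "delta_Hausdorff X" and Y: "delta_Hausdorff Y"
  shows "delta_Hausdorff (Top_prod X Y)"
proof (rule delta_HausdorffI)
  fix \<gamma> assume \<gamma>: "pathin (Top_prod X Y) \<gamma>"
  let ?Z = "Top_prod X Y"
  have "closedin (prod_topology ?Z unit_interval) {z \<in> topspace ?Z \<times> {0..1}. fst (fst z) = (fst \<circ> \<gamma>) (snd z)}"
    by (intro closedin_coincidence_with_path[OF X] pathin_compose[OF \<gamma>] continuous_map_Top_prod_fst)
  moreover have "closedin (prod_topology ?Z unit_interval) {z \<in> topspace ?Z \<times> {0..1}. snd (fst z) = (snd \<circ> \<gamma>) (snd z)}"
    by (intro closedin_coincidence_with_path[OF Y] pathin_compose[OF \<gamma>] continuous_map_Top_prod_snd)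
  ultimately have "closedin (prod_topology ?Z unit_interval)
      ({z \<in> topspace ?Z \<times> {0..1}. fst (fst z) = (fst \<circ> \<gamma>) (snd z)} \<inter>
       {z \<in> topspace ?Z \<times> {0..1}. snd (fst z) = (snd \<circ> \<gamma>) (snd z)})"
    by (rule closedin_Int)
  moreover have "{z \<in> topspace ?Z \<times> {0..1}. fst (fst z) = (fst \<circ> \<gamma>) (snd z)} \<inter>
       {z \<in> topspace ?Z \<times> {0..1}. snd (fst z) = (snd \<circ> \<gamma>) (snd z)} =
       {z \<in> topspace ?Z \<times> {0..1}. fst z = \<gamma> (snd z)}"
    by (auto simp: prod_eq_iff)
  ultimately show "closedin (prod_topology ?Z unit_interval) {z \<in> topspace ?Z \<times> {0..1}. fst z = \<gamma> (snd z)}"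
    by metis
qed

lemma in_Top_Top_prod: "in_Top T X \<Longrightarrow> in_Top T Y \<Longrightarrow> in_Top T (Top_prod X Y)"
  by (simp add: in_Top_def delta_generated_Top_prod delta_Hausdorff_Top_prod)

lemma in_Top_point: "in_Top T (discrete_topology {p})"
proof -
  have "closedin (discrete_topology {p}) (\<gamma> ` {0..1})" if "pathin (discrete_topology {p}) \<gamma>" for \<gamma>
    using that unfolding pathin_def continuous_map_def by auto
  then show ?thesis
    by (auto simp: in_Top_def delta_generated_def delta_open_def delta_Hausdorff_def)
qed

section \<open>Quotients in Top\<close>

lemma topspace_quotient_space:
  assumes "equiv (topspace X) R"
  shows "topspace (quotient_space X R) = topspace X // R"
proof
  show "topspace (quotient_space X R) \<subseteq> topspace X // R"
    using openin_topspace[of "quotient_space X R"] unfolding openin_quotient_space[OF assms] by blast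
  have "openin (quotient_space X R) (topspace X // R)"
    unfolding openin_quotient_space[OF assms] by (simp add: Union_quotient[OF assms])
  then show "topspace X // R \<subseteq> topspace (quotient_space X R)" by (rule openin_subset)
qed

lemma quotient_map_quotient_space:
  assumes "equiv (topspace X) R"
  shows "quotient_map X (quotient_space X R) (\<lambda>x. R `` {x})"
  unfolding quotient_map_def
proof (intro conjI allI impI)
  show "(\<lambda>x. R `` {x}) ` topspace X = topspace (quotient_space X R)"
    by (auto simp: topspace_quotient_space[OF assms] quotient_def)
  fix \<U> assume "\<U> \<subseteq> topspace (quotient_space X R)"
  then have sub: "\<U> \<subseteq> topspace X // R" by (simp add: topspace_quotient_space[OF assms])
  have "{x \<in> topspace X. R `` {x} \<in> \<U>} = \<Union>\<U>"
  proof (intro subset_antisym subsetI)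
    fix x assume "x \<in> {x \<in> topspace X. R `` {x} \<in> \<U>}"
    then show "x \<in> \<Union>\<U>" using equiv_class_self[OF assms] by blast
  next
    fix x assume "x \<in> \<Union>\<U>"
    then obtain C where C: "C \<in> \<U>" "x \<in> C" by blast
    then have "C \<in> topspace X // R" using sub by blast
    then have "C = R `` {x}" "x \<in> topspace X"
      using C(2) assms by (metis Image_singleton_iff equiv_class_eq_iff quotientE)+
    with C show "x \<in> {x \<in> topspace X. R `` {x} \<in> \<U>}" by simp
  qed
  then show "openin X {x \<in> topspace X. R `` {x} \<in> \<U>} = openin (quotient_space X R) \<U>"
    by (simp add: openin_quotient_space[OF assms] sub)
qed

definition kernel_on :: "'a set \<Rightarrow> ('a \<Rightarrow> 'b) \<Rightarrow> ('a \<times> 'a) set" where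
  "kernel_on A h = {(x, y). x \<in> A \<and> y \<in> A \<and> h x = h y}"

lemma equiv_kernel_on: "equiv A (kernel_on A h)"
  by (auto simp: equiv_def refl_on_def sym_def trans_def kernel_on_def)

text \<open>The quotient by the kernel of \<open>h\<close> injects continuously into \<open>Z\<close>, which is all that the Delta-Hausdorff property needs.\<close>

lemma in_Top_quotient_kernel_on:
  assumes X: "delta_generated X" and Z: "in_Top T Z" and h: "continuous_map X Z h"
  shows "in_Top T (quotient_space X (kernel_on (topspace X) h))"
proof -
  let ?R = "kernel_on (topspace X) h"
  note q = quotient_map_quotient_space[OF equiv_kernel_on[of "topspace X" h]]
  define h' where "h' C = the_elem (h ` C)" for C
  have hq: "h' (?R `` {x}) = h x" if "x \<in> topspace X" for x
  proof -
    have "h ` (?R `` {x}) = {h x}" using that by (auto simp: kernel_on_def)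
    then show ?thesis by (simp add: h'_def)
  qed
  have "continuous_map X Z (h' \<circ> (\<lambda>x. ?R `` {x}))"
    by (rule continuous_map_eq[OF h]) (simp add: hq)
  then have c: "continuous_map (quotient_space X ?R) Z h'"
    by (rule continuous_compose_quotient_map[OF q])
  have inj: "x = y" if xy: "x \<in> topspace (quotient_space X ?R)" "y \<in> topspace (quotient_space X ?R)"
     "h' x = h' y" for x y
  proof -
    have "\<exists>a\<in>topspace X. x = ?R `` {a}" "\<exists>b\<in>topspace X. y = ?R `` {b}"
      using xy(1,2) quotient_imp_surjective_map[OF q] by blast+
    then obtain a b where ab: "x = ?R `` {a}" "y = ?R `` {b}" "a \<in> topspace X" "b \<in> topspace X"
      by blast
    then have "h a = h b" using xy(3) by (simp add: hq)
    with ab(3,4) have "(a, b) \<in> ?R" by (simp add: kernel_on_def)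
    with ab(1,2) show ?thesis using equiv_class_eq[OF equiv_kernel_on] by simp
  qed
  have "delta_Hausdorff (quotient_space X ?R)" if "delta_Hausdorff Z"
    by (rule delta_Hausdorff_jointly_injective[of "{()}" "\<lambda>_. Z" _ "\<lambda>_. h'"])
      (use c that inj in auto)
  then show ?thesis
    using Z delta_generated_quotient_map_image[OF q X] by (simp add: in_Top_def)
qed

lemma Top_equiv_subset_kernel_on:
  assumes X: "delta_generated X" and Z: "in_Top T Z" and h: "continuous_map X Z h"
    and R0: "R0 \<subseteq> kernel_on (topspace X) h"
  shows "Top_equiv T X R0 \<subseteq> kernel_on (topspace X) h"
  unfolding Top_equiv_def
  by (rule Inter_lower) (use R0 equiv_kernel_on in_Top_quotient_kernel_on[OF X Z h] in auto)

lemma equiv_Inter: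
  assumes ne: "\<R> \<noteq> {}" and eq: "\<And>R. R \<in> \<R> \<Longrightarrow> equiv A R"
  shows "equiv A (\<Inter>\<R>)"
proof (rule equivI)
  have R: "R \<subseteq> A \<times> A" "refl_on A R" "sym R" "trans R" if "R \<in> \<R>" for R
    using eq[OF that] by (auto elim: equivE)
  show "\<Inter>\<R> \<subseteq> A \<times> A" using R(1) ne by blast
  show "refl_on A (\<Inter>\<R>)" by (intro refl_onI InterI) (rule refl_onD[OF R(2)])
  show "sym (\<Inter>\<R>)" by (intro symI InterI) (blast intro: symD[OF R(3)])
  show "trans (\<Inter>\<R>)" by (intro transI InterI) (blast intro: transD[OF R(4)])
qed

text \<open>The projections to the quotients by the members of the family are jointly injective on the quotient by the intersection.\<close>

lemma delta_Hausdorff_quotient_Inter: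
  assumes ne: "\<R> \<noteq> {}" and eq: "\<And>R. R \<in> \<R> \<Longrightarrow> equiv (topspace X) R"
    and H: "\<And>R. R \<in> \<R> \<Longrightarrow> delta_Hausdorff (quotient_space X R)"
  shows "delta_Hausdorff (quotient_space X (\<Inter>\<R>))"
proof (rule delta_Hausdorff_jointly_injective[of \<R> "quotient_space X" _ "\<lambda>R C. R `` C"])
  let ?R = "\<Inter>\<R>"
  have e: "equiv (topspace X) ?R" using ne eq by (rule equiv_Inter)
  note q = quotient_map_quotient_space[OF e]
  show "delta_Hausdorff (quotient_space X R)" if "R \<in> \<R>" for R
    using that by (rule H)
  show "continuous_map (quotient_space X ?R) (quotient_space X R) (\<lambda>C. R `` C)" if R: "R \<in> \<R>" for R
  proof (rule continuous_compose_quotient_map[OF q])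
    have "R `` (?R `` {x}) = R `` {x}" if x: "x \<in> topspace X" for x
    proof
      show "R `` (?R `` {x}) \<subseteq> R `` {x}"
        using R transD[of R x] eq[OF R] by (auto elim: equivE)
      show "R `` {x} \<subseteq> R `` (?R `` {x})"
        using equiv_class_self[OF e x] by (intro Image_mono) auto
    qed
    then show "continuous_map X (quotient_space X R) ((\<lambda>C. R `` C) \<circ> (\<lambda>x. ?R `` {x}))"
      by (intro continuous_map_eq[OF quotient_imp_continuous_map[OF quotient_map_quotient_space[OF eq[OF R]]]]) simp
  qed
  fix C C' assume C: "C \<in> topspace (quotient_space X ?R)" "C' \<in> topspace (quotient_space X ?R)"
    and CC': "\<And>R. R \<in> \<R> \<Longrightarrow> R `` C = R `` C'"
  obtain x where x: "x \<in> topspace X" "C = ?R `` {x}"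
    using C(1) unfolding topspace_quotient_space[OF e] by (rule quotientE)
  obtain y where y: "y \<in> topspace X" "C' = ?R `` {y}"
    using C(2) unfolding topspace_quotient_space[OF e] by (rule quotientE)
  have "(x, y) \<in> ?R"
  proof (rule InterI)
    fix R assume R: "R \<in> \<R>"
    have "y \<in> R `` C'"
      using equiv_class_self[OF e y(1)] equiv_class_self[OF eq[OF R] y(1)] y(2) by blast
    then have "y \<in> R `` C" using CC'[OF R] by simp
    then obtain c where "(x, c) \<in> R" "(c, y) \<in> R" using x(2) R by blast
    then show "(x, y) \<in> R" using eq[OF R] by (meson equivE transD)
  qed
  then show "C = C'" unfolding x(2) y(2) by (rule equiv_class_eq[OF e])
qed

text \<open>The relation identifying all points is the kernel of a map to a point, which belongs to Top. Hence the family
  intersected in \<open>Top_equiv\<close> is nonempty, and its intersection has a quotient in Top as well.\<close>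

lemma
  assumes X: "delta_generated X" and R0: "R0 \<subseteq> topspace X \<times> topspace X"
  shows equiv_Top_equiv: "equiv (topspace X) (Top_equiv T X R0)"
    and generators_subset_Top_equiv: "R0 \<subseteq> Top_equiv T X R0"
    and in_Top_Top_quotient: "in_Top T (Top_quotient T X R0)"
proof -
  define \<R> where "\<R> = {R. equiv (topspace X) R \<and> R0 \<subseteq> R \<and> in_Top T (quotient_space X R)}"
  have Top_equiv: "Top_equiv T X R0 = \<Inter>\<R>"
    by (simp add: Top_equiv_def \<R>_def)
  have "R0 \<subseteq> kernel_on (topspace X) (\<lambda>_. ())"
    using R0 by (auto simp: kernel_on_def)
  moreover have "continuous_map X (discrete_topology {()}) (\<lambda>_. ())" by simp
  ultimately have "kernel_on (topspace X) (\<lambda>_. ()) \<in> \<R>"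
    using in_Top_quotient_kernel_on[OF X in_Top_point, of "()" "\<lambda>_. ()" T]
      equiv_kernel_on[of "topspace X" "\<lambda>_. ()"] by (simp add: \<R>_def)
  then have ne: "\<R> \<noteq> {}" by blast
  have eq: "equiv (topspace X) R" if "R \<in> \<R>" for R
    using that by (simp add: \<R>_def)
  have e: "equiv (topspace X) (\<Inter>\<R>)" using ne eq by (rule equiv_Inter)
  then show "equiv (topspace X) (Top_equiv T X R0)" unfolding Top_equiv .
  show "R0 \<subseteq> Top_equiv T X R0" unfolding Top_equiv_def by blast
  have "delta_generated (quotient_space X (\<Inter>\<R>))"
    by (rule delta_generated_quotient_map_image[OF quotient_map_quotient_space[OF e] X])
  moreover have "delta_Hausdorff (quotient_space X (\<Inter>\<R>))" if T: "T = Only_Delta_Hausdorff"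
  proof (rule delta_Hausdorff_quotient_Inter[OF ne eq])
    fix R assume "R \<in> \<R>"
    then have "in_Top T (quotient_space X R)" unfolding \<R>_def by blast
    with T show "delta_Hausdorff (quotient_space X R)" by (simp add: in_Top_def)
  qed
  ultimately show "in_Top T (Top_quotient T X R0)"
    by (simp add: in_Top_def Top_quotient_def Top_equiv)
qed

section \<open>Evaluation of mapping spaces\<close>

lemma topspace_compact_open_topology: "topspace (compact_open_topology X Y) = maps X Y"
proof -
  have "maps X Y \<in> {{f \<in> maps X Y. f ` K \<subseteq> U} |K U. compactin X K \<and> openin Y U}"
    by (rule CollectI, intro exI[of _ "{}"]) auto
  then show ?thesis by (force simp: compact_open_topology_def)
qed

text \<open>For \<open>v\<close> near \<open>w\<close> the point \<open>p v\<close> stays in the compact set \<open>p ` K\<close>, which \<open>g w\<close> maps into \<open>U\<close>, and the maps doing so form a subbasic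
  open set of the compact-open topology.\<close>

lemma continuous_map_evaluation:
  assumes W: "locally_compact_space W" "regular_space W"
    and g: "continuous_map W (compact_open_topology X Y) g" and p: "continuous_map W X p"
  shows "continuous_map W Y (\<lambda>w. g w (p w))"
proof -
  have g_maps: "g w \<in> maps X Y" if "w \<in> topspace W" for w
    using continuous_map_funspace[OF g] that topspace_compact_open_topology[of X Y] by blast
  then have gm: "continuous_map X Y (g w)" if "w \<in> topspace W" for w
    using that by (simp add: maps_def)
  have base: "neighbourhood_base_of (\<lambda>C. compactin W C \<and> closedin W C) W"
    using W locally_compact_regular_space_neighbourhood_base by blast
  show ?thesis
    unfolding continuous_map_def
  proof (intro conjI allI impI)
    show "(\<lambda>w. g w (p w)) \<in> topspace W \<rightarrow> topspace Y"
    proof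
      fix w assume w: "w \<in> topspace W"
      show "g w (p w) \<in> topspace Y"
        using funcset_mem[OF continuous_map_funspace[OF gm[OF w]]
            funcset_mem[OF continuous_map_funspace[OF p] w]] .
    qed
    fix U assume U: "openin Y U"
    show "openin W {w \<in> topspace W. g w (p w) \<in> U}"
    proof (subst openin_subopen, intro ballI)
      fix w assume w: "w \<in> {w \<in> topspace W. g w (p w) \<in> U}"
      have "continuous_map W Y (g w \<circ> p)"
        using gm w by (intro continuous_map_compose[OF p]) auto
      from openin_continuous_map_preimage[OF this U]
      have "openin W {v \<in> topspace W. g w (p v) \<in> U}" by simp
      moreover have "w \<in> {v \<in> topspace W. g w (p v) \<in> U}" using w by simp
      ultimately obtain V K where V: "openin W V" "w \<in> V" "V \<subseteq> K" "compactin W K"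
          "K \<subseteq> {v \<in> topspace W. g w (p v) \<in> U}"
        using base[unfolded neighbourhood_base_of, rule_format,
            of "{v \<in> topspace W. g w (p v) \<in> U}" w]
        by (elim meta_impE exE conjE) (rule conjI)
      let ?S = "{f \<in> maps X Y. f ` (p ` K) \<subseteq> U}"
      have "openin (compact_open_topology X Y) ?S"
        unfolding compact_open_topology_def
        by (rule topology_generated_by_Basis, rule CollectI, intro exI conjI, rule refl)
          (rule image_compactin[OF V(4) p], rule U)
      from openin_continuous_map_preimage[OF g this]
      have o: "openin W ({v \<in> topspace W. g v \<in> ?S} \<inter> V)" using V(1) by (rule openin_Int)
      have "g w \<in> maps X Y" using g_maps w by simp
      moreover have "g w ` (p ` K) \<subseteq> U" using V(5) by blast
      ultimately have "w \<in> {v \<in> topspace W. g v \<in> ?S} \<inter> V" using V(2) w by simp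
      moreover have "{v \<in> topspace W. g v \<in> ?S} \<inter> V \<subseteq> {w \<in> topspace W. g w (p w) \<in> U}"
        using V(3) by blast
      ultimately show "\<exists>S. openin W S \<and> w \<in> S \<and> S \<subseteq> {w \<in> topspace W. g w (p w) \<in> U}"
        using o by (intro exI conjI)
    qed
  qed
qed

lemma compact_Hausdorff_simplex_space:
  "compact_space (simplex_space n)" "Hausdorff_space (simplex_space n)"
  by (simp_all add: compactin_standard_simplex compact_space_subtopology Hausdorff_space_subtopology
      Hausdorff_space_product_topology)

text \<open>For arbitrary \<open>X\<close>, evaluation is continuous along every simplex, since simplices are compact Hausdorff; on the product in
  Top this suffices.\<close>

lemma continuous_map_Top_map_evaluation:
  "continuous_map (Top_prod (Top_map X Y) X) Y (\<lambda>(f, x). f x)"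
proof (rule continuous_map_from_delta_generated[OF delta_generated_Top_prod])
  have id: "continuous_map (Top_map X Y) (compact_open_topology X Y) (\<lambda>f. f)"
    unfolding Top_map_def by (rule continuous_map_from_delta_kelley) simp
  show "(\<lambda>(f, x). f x) \<in> topspace (Top_prod (Top_map X Y) X) \<rightarrow> topspace Y"
  proof
    fix z assume "z \<in> topspace (Top_prod (Top_map X Y) X)"
    then have "continuous_map X Y (fst z)" "snd z \<in> topspace X"
      by (auto simp: Top_map_def topspace_compact_open_topology maps_def)
    then have "fst z (snd z) \<in> topspace Y"
      by (rule funcset_mem[OF continuous_map_funspace])
    then show "(case z of (f, x) \<Rightarrow> f x) \<in> topspace Y" by (simp add: case_prod_beta)
  qed
  fix n \<sigma> assume \<sigma>: "continuous_map (simplex_space n) (Top_prod (Top_map X Y) X) \<sigma>"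
  have "continuous_map (simplex_space n) Y (\<lambda>t. (fst \<circ> \<sigma>) t ((snd \<circ> \<sigma>) t))"
  proof (rule continuous_map_evaluation[where g = "fst \<circ> \<sigma>" and p = "snd \<circ> \<sigma>"])
    show "locally_compact_space (simplex_space n)" "regular_space (simplex_space n)"
      using compact_Hausdorff_simplex_space
      by (blast intro: compact_imp_locally_compact_space compact_Hausdorff_imp_regular_space)+
    show "continuous_map (simplex_space n) (compact_open_topology X Y) (fst \<circ> \<sigma>)"
      using continuous_map_compose[OF continuous_map_compose[OF \<sigma> continuous_map_Top_prod_fst] id]
      by (simp add: o_def)
    show "continuous_map (simplex_space n) X (snd \<circ> \<sigma>)"
      by (rule continuous_map_compose[OF \<sigma> continuous_map_Top_prod_snd])
  qed
  then show "continuous_map (simplex_space n) Y ((\<lambda>(f, x). f x) \<circ> \<sigma>)"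
    by (simp add: o_def case_prod_beta)
qed

lemma continuous_map_pointwise_Top_prod:
  assumes h: "continuous_map (Top_prod X Y) Z (\<lambda>(x, y). h x y)" and W: "delta_generated W"
    and f: "continuous_map W X f" and g: "continuous_map W Y g"
  shows "continuous_map W Z (\<lambda>w. h (f w) (g w))"
  using continuous_map_compose[OF continuous_map_into_Top_prod[OF W f g] h] by (simp add: o_def)

section \<open>Maps out of sums and quotients in Top\<close>

lemma continuous_map_prod_from_sum_topology:
  assumes f: "\<And>i. i \<in> I \<Longrightarrow> continuous_map (prod_topology Z (X i)) Y (\<lambda>(z, x). f (z, i, x))"
  shows "continuous_map (prod_topology Z (sum_topology X I)) Y f"
  unfolding continuous_map_def
proof (intro conjI allI impI)
  have "f (z, i, x) \<in> topspace Y" if "z \<in> topspace Z" "i \<in> I" "x \<in> topspace (X i)" for z i x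
    using funcset_mem[OF continuous_map_funspace[OF f[OF that(2)]], of "(z, x)"] that by simp
  then show "f \<in> topspace (prod_topology Z (sum_topology X I)) \<rightarrow> topspace Y" by auto
  fix U assume U: "openin Y U"
  show "openin (prod_topology Z (sum_topology X I)) {v \<in> topspace (prod_topology Z (sum_topology X I)). f v \<in> U}"
    unfolding openin_prod_topology_alt
  proof (intro allI impI)
    fix z ix assume z: "(z, ix) \<in> {v \<in> topspace (prod_topology Z (sum_topology X I)). f v \<in> U}"
    then obtain i x where ix: "ix = (i, x)" "i \<in> I" "x \<in> topspace (X i)" "z \<in> topspace Z" by auto
    from openin_continuous_map_preimage[OF f[OF ix(2)] U]
    have o: "openin (prod_topology Z (X i)) {v \<in> topspace Z \<times> topspace (X i). (case v of (z, x) \<Rightarrow> f (z, i, x)) \<in> U}"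
      by simp
    have "(z, x) \<in> {v \<in> topspace Z \<times> topspace (X i). (case v of (z, x) \<Rightarrow> f (z, i, x)) \<in> U}"
      using z ix by simp
    with o obtain A B where A: "openin Z A" "z \<in> A" and B: "openin (X i) B" "x \<in> B"
      and AB: "A \<times> B \<subseteq> {v \<in> topspace Z \<times> topspace (X i). (case v of (z, x) \<Rightarrow> f (z, i, x)) \<in> U}"
      unfolding openin_prod_topology_alt by meson
    have "openin (sum_topology X I) ((\<lambda>x. (i, x)) ` B)"
      using open_map_component_injection[OF ix(2), of X] B(1) unfolding open_map_def by blast
    moreover have "A \<times> (\<lambda>x. (i, x)) ` B \<subseteq> {v \<in> topspace (prod_topology Z (sum_topology X I)). f v \<in> U}"
      using AB ix(2) by fastforce
    ultimately show "\<exists>A B. openin Z A \<and> openin (sum_topology X I) B \<and> z \<in> A \<and> ix \<in> B \<and>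
        A \<times> B \<subseteq> {v \<in> topspace (prod_topology Z (sum_topology X I)). f v \<in> U}"
      using A B ix(1) by blast
  qed
qed

lemma continuous_map_from_sum_topology:
  assumes f: "\<And>i. i \<in> I \<Longrightarrow> continuous_map (X i) Y (\<lambda>x. f (i, x))"
  shows "continuous_map (sum_topology X I) Y f"
  unfolding continuous_map_def
proof (intro conjI allI impI)
  have "f (i, x) \<in> topspace Y" if "i \<in> I" "x \<in> topspace (X i)" for i x
    using funcset_mem[OF continuous_map_funspace[OF f[OF that(1)]] that(2)] .
  then show "f \<in> topspace (sum_topology X I) \<rightarrow> topspace Y" by auto
  fix U assume U: "openin Y U"
  have "{x. (i, x) \<in> {v \<in> topspace (sum_topology X I). f v \<in> U}} = {x \<in> topspace (X i). f (i, x) \<in> U}"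
    if "i \<in> I" for i using that by auto
  then show "openin (sum_topology X I) {v \<in> topspace (sum_topology X I). f v \<in> U}"
    using openin_continuous_map_preimage[OF f U] by (auto simp: openin_sum_topology)
qed

text \<open>The universal property of quotients in Top: the kernel of \<open>h\<close> is one of the relations that \<open>Top_equiv\<close> intersects.\<close>

lemma Top_equiv_respects:
  assumes X: "delta_generated X" and Z: "in_Top T Z" and h: "continuous_map X Z h"
    and R0: "R0 \<subseteq> topspace X \<times> topspace X" "\<And>x y. (x, y) \<in> R0 \<Longrightarrow> h x = h y"
    and xy: "(x, y) \<in> Top_equiv T X R0"
  shows "h x = h y"
proof -
  have "R0 \<subseteq> kernel_on (topspace X) h"
    using R0 by (auto simp: kernel_on_def)
  from Top_equiv_subset_kernel_on[OF X Z h this] xy show ?thesis by (auto simp: kernel_on_def)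
qed

section \<open>The tensor product of two P-spaces as a quotient\<close>

lemma (in Top_category) Comp_mor:
  assumes "a \<in> Ob P" "b \<in> Ob P" "c \<in> Ob P" "f \<in> mor P a b" "g \<in> mor P b c"
  shows "Comp P a b c g f \<in> mor P a c"
  using funcset_mem[OF continuous_map_funspace[OF Comp_continuous], of a b c "(g, f)"] assms by simp

lemma (in strict_semimonoidal_Top_category) tmor_mor:
  assumes "a \<in> Ob P" "a' \<in> Ob P" "b \<in> Ob P" "b' \<in> Ob P" "\<alpha> \<in> mor P a a'" "\<beta> \<in> mor P b b'"
  shows "tmor P a a' b b' \<alpha> \<beta> \<in> mor P (tob P a b) (tob P a' b')"
  using funcset_mem[OF continuous_map_funspace[OF tmor_continuous], of a a' b b' "(\<alpha>, \<beta>)"] assms by simp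

lemma (in P_space) Act_jointly_continuous:
  assumes "a \<in> Ob P" "b \<in> Ob P"
  shows "continuous_map (Top_prod (Hom P a b) (Spc D b)) (Spc D a) (\<lambda>(\<phi>, x). Act D a b \<phi> x)"
proof -
  let ?W = "Top_prod (Hom P a b) (Spc D b)"
  let ?g = "\<lambda>\<phi>. restrict (Act D a b \<phi>) (topspace (Spc D b))"
  have "continuous_map ?W (Top_map (Spc D b) (Spc D a)) (\<lambda>w. ?g (fst w))"
    using continuous_map_compose[OF continuous_map_Top_prod_fst Act_continuous[OF assms]] by (simp add: o_def)
  from continuous_map_pointwise_Top_prod[OF continuous_map_Top_map_evaluation delta_generated_Top_prod
      this continuous_map_Top_prod_snd]
  have "continuous_map ?W (Spc D a) (\<lambda>w. ?g (fst w) (snd w))" .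
  then show ?thesis
    by (rule continuous_map_eq) auto
qed

lemma (in P_space) continuous_map_Act:
  assumes "a \<in> Ob P" "b \<in> Ob P" "delta_generated W"
    and "continuous_map W (Hom P a b) p" "continuous_map W (Spc D b) f"
  shows "continuous_map W (Spc D a) (\<lambda>w. Act D a b (p w) (f w))"
  using continuous_map_pointwise_Top_prod[OF Act_jointly_continuous[OF assms(1,2)] assms(3-5)] .

lemma (in P_space) Act_closed:
  assumes "a \<in> Ob P" "b \<in> Ob P" "\<phi> \<in> mor P a b" "x \<in> topspace (Spc D b)"
  shows "Act D a b \<phi> x \<in> topspace (Spc D a)"
  using funcset_mem[OF continuous_map_funspace[OF Act_jointly_continuous[OF assms(1,2)]], of "(\<phi>, x)"] assms by simp

locale P_space_pair =
  strict_semimonoidal_Top_category T P + D: P_space T P D + E: P_space T P E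
  for T and P :: "('o, 'm) semimonoidal" and D :: "('o, 'm, 'x) pspace" and E :: "('o, 'm, 'y) pspace" +
  fixes L :: 'o
  assumes L_Ob: "L \<in> Ob P"
begin

abbreviation summand :: "'o \<Rightarrow> 'o \<Rightarrow> ('m \<times> 'x \<times> 'y) topology" where
  "summand a b \<equiv> Top_prod (Hom P L (tob P a b)) (Top_prod (Spc D a) (Spc E b))"

abbreviation triples :: "('o, 'm, 'x, 'y) triple topology" where
  "triples \<equiv> tensor_sum P D E L"

abbreviation proj :: "('o, 'm, 'x, 'y) triple \<Rightarrow> ('o, 'm, 'x, 'y) triple set" where
  "proj z \<equiv> tensor_equiv T P D E L `` {z}"

lemma continuous_map_summand_coordinates:
  assumes f: "continuous_map W (summand a b) f"
  shows "continuous_map W (Hom P L (tob P a b)) (\<lambda>w. fst (f w))"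
    and "continuous_map W (Spc D a) (\<lambda>w. fst (snd (f w)))"
    and "continuous_map W (Spc E b) (\<lambda>w. snd (snd (f w)))"
  using continuous_map_compose[OF f continuous_map_Top_prod_fst]
    continuous_map_compose[OF continuous_map_compose[OF f continuous_map_Top_prod_snd] continuous_map_Top_prod_fst]
    continuous_map_compose[OF continuous_map_compose[OF f continuous_map_Top_prod_snd] continuous_map_Top_prod_snd]
  by (simp_all add: o_def)

lemma topspace_triples:
  "((a, b), (\<psi>, x, y)) \<in> topspace triples \<longleftrightarrow>
     a \<in> Ob P \<and> b \<in> Ob P \<and> \<psi> \<in> mor P L (tob P a b) \<and> x \<in> topspace (Spc D a) \<and> y \<in> topspace (Spc E b)"
  by (auto simp: tensor_sum_def)

lemma triplesE:
  assumes "z \<in> topspace triples"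
  obtains a b \<psi> x y where "z = ((a, b), (\<psi>, x, y))" "a \<in> Ob P" "b \<in> Ob P" "\<psi> \<in> mor P L (tob P a b)"
    "x \<in> topspace (Spc D a)" "y \<in> topspace (Spc E b)"
proof -
  obtain a b \<psi> x y where z: "z = ((a, b), (\<psi>, x, y))" by (metis surj_pair)
  with assms show thesis using that by (simp add: topspace_triples)
qed

lemma delta_generated_triples: "delta_generated triples"
  unfolding tensor_sum_def
  by (rule delta_generated_sum_topology) (auto simp: delta_generated_Top_prod)

lemma continuous_map_from_triples:
  assumes "\<And>a b. \<lbrakk>a \<in> Ob P; b \<in> Ob P\<rbrakk> \<Longrightarrow> continuous_map (summand a b) Y (\<lambda>w. f ((a, b), w))"
  shows "continuous_map triples Y f"
  unfolding tensor_sum_def using assms by (intro continuous_map_from_sum_topology) auto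

lemma continuous_map_interval_prod_triples:
  assumes "\<And>a b. \<lbrakk>a \<in> Ob P; b \<in> Ob P\<rbrakk> \<Longrightarrow>
    continuous_map (prod_topology unit_interval (summand a b)) Y (\<lambda>v. f (fst v, (a, b), snd v))"
  shows "continuous_map (prod_topology unit_interval triples) Y f"
  unfolding tensor_sum_def using assms
  by (intro continuous_map_prod_from_sum_topology) (auto simp: case_prod_unfold)

lemma tensor_gen_subset: "tensor_gen P D E L \<subseteq> topspace triples \<times> topspace triples"
proof
  fix p assume "p \<in> tensor_gen P D E L"
  then obtain a a' b b' \<alpha> \<beta> \<psi> x' y' where
    p: "p = (((a', b'), (post_tensor P L a a' b b' \<alpha> \<beta> \<psi>, x', y')),
             ((a, b), (\<psi>, Act D a a' \<alpha> x', Act E b b' \<beta> y')))"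
    and m: "a \<in> Ob P" "a' \<in> Ob P" "b \<in> Ob P" "b' \<in> Ob P" "\<alpha> \<in> mor P a a'" "\<beta> \<in> mor P b b'"
      "\<psi> \<in> mor P L (tob P a b)" "x' \<in> topspace (Spc D a')" "y' \<in> topspace (Spc E b')"
    unfolding tensor_gen_def by blast
  have "post_tensor P L a a' b b' \<alpha> \<beta> \<psi> \<in> mor P L (tob P a' b')"
    using m L_Ob by (intro Comp_mor tob_Ob tmor_mor)
  then show "p \<in> topspace triples \<times> topspace triples"
    using m by (simp add: p topspace_triples D.Act_closed E.Act_closed)
qed

lemma equiv_tensor_equiv: "equiv (topspace triples) (tensor_equiv T P D E L)"
  unfolding tensor_equiv_def by (rule equiv_Top_equiv[OF delta_generated_triples tensor_gen_subset])

lemma Spc_tensor: "Spc (tensor T P D E) L = quotient_space triples (tensor_equiv T P D E L)"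
  by (simp add: tensor_def Top_quotient_def tensor_equiv_def)

lemma quotient_map_proj: "quotient_map triples (Spc (tensor T P D E) L) proj"
  unfolding Spc_tensor by (rule quotient_map_quotient_space[OF equiv_tensor_equiv])

lemma in_Top_tensor: "in_Top T (Spc (tensor T P D E) L)"
  using in_Top_Top_quotient[OF delta_generated_triples tensor_gen_subset, of T]
  by (simp add: tensor_def)

lemma proj_generator:
  assumes "a \<in> Ob P" "a' \<in> Ob P" "b \<in> Ob P" "b' \<in> Ob P" "\<alpha> \<in> mor P a a'" "\<beta> \<in> mor P b b'"
      "\<psi> \<in> mor P L (tob P a b)" "x' \<in> topspace (Spc D a')" "y' \<in> topspace (Spc E b')"
  shows "proj ((a', b'), (post_tensor P L a a' b b' \<alpha> \<beta> \<psi>, x', y')) =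
         proj ((a, b), (\<psi>, Act D a a' \<alpha> x', Act E b b' \<beta> y'))"
proof -
  have "(((a', b'), (post_tensor P L a a' b b' \<alpha> \<beta> \<psi>, x', y')),
         ((a, b), (\<psi>, Act D a a' \<alpha> x', Act E b b' \<beta> y'))) \<in> tensor_gen P D E L"
    unfolding tensor_gen_def using assms by blast
  then have "(((a', b'), (post_tensor P L a a' b b' \<alpha> \<beta> \<psi>, x', y')),
         ((a, b), (\<psi>, Act D a a' \<alpha> x', Act E b b' \<beta> y'))) \<in> tensor_equiv T P D E L"
    unfolding tensor_equiv_def
    by (rule subsetD[OF generators_subset_Top_equiv[OF delta_generated_triples tensor_gen_subset]])
  then show ?thesis by (rule equiv_class_eq[OF equiv_tensor_equiv])
qed

text \<open>The coend relations for a function on representatives. For a continuous function into an object of Top they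
  already give constancy on the classes of the possibly larger relation \<open>tensor_equiv\<close>.\<close>

definition coend_compatible :: "(('o, 'm, 'x, 'y) triple \<Rightarrow> 'z) \<Rightarrow> bool" where
  "coend_compatible h \<longleftrightarrow>
     (\<forall>a\<in>Ob P. \<forall>a'\<in>Ob P. \<forall>b\<in>Ob P. \<forall>b'\<in>Ob P. \<forall>\<alpha>\<in>mor P a a'. \<forall>\<beta>\<in>mor P b b'.
        \<forall>\<psi>\<in>mor P L (tob P a b). \<forall>x'\<in>topspace (Spc D a'). \<forall>y'\<in>topspace (Spc E b').
          h ((a', b'), (post_tensor P L a a' b b' \<alpha> \<beta> \<psi>, x', y')) =
          h ((a, b), (\<psi>, Act D a a' \<alpha> x', Act E b b' \<beta> y')))"

lemma constant_on_class:
  assumes h: "continuous_map triples Z h" "in_Top T Z" "coend_compatible h"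
    and z: "z \<in> topspace triples"
  shows "h ` proj z = {h z}"
proof -
  have gen: "h u = h v" if "(u, v) \<in> tensor_gen P D E L" for u v
    using that h(3) unfolding tensor_gen_def coend_compatible_def by blast
  have "h v = h z" if "v \<in> proj z" for v
  proof -
    have "(z, v) \<in> Top_equiv T triples (tensor_gen P D E L)"
      using that by (simp add: tensor_equiv_def)
    then show ?thesis
      using Top_equiv_respects[OF delta_generated_triples h(2,1) tensor_gen_subset gen] by metis
  qed
  moreover have "z \<in> proj z" by (rule equiv_class_self[OF equiv_tensor_equiv z])
  ultimately show ?thesis by blast
qed

lemma continuous_map_from_tensor:
  assumes g: "\<And>z. z \<in> topspace triples \<Longrightarrow> g (proj z) = h z" and h: "continuous_map triples Z h"
  shows "continuous_map (Spc (tensor T P D E) L) Z g"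
  by (rule continuous_compose_quotient_map[OF quotient_map_proj], rule continuous_map_eq[OF h]) (simp add: g)

lemma tensorE:
  assumes "C \<in> topspace (Spc (tensor T P D E) L)"
  obtains z where "z \<in> topspace triples" "C = proj z"
  using assms quotient_imp_surjective_map[OF quotient_map_proj] by blast

lemma continuous_map_component:
  assumes "a \<in> Ob P" "b \<in> Ob P" "continuous_map W (summand a b) f"
  shows "continuous_map W (Spc (tensor T P D E) L) (\<lambda>w. proj ((a, b), f w))"
proof -
  have "continuous_map (summand a b) triples (\<lambda>w. ((a, b), w))"
    using continuous_map_component_injection[of "(a, b)" "Ob P \<times> Ob P" "\<lambda>(a, b). summand a b"] assms(1,2)
    by (simp add: tensor_sum_def)
  from continuous_map_compose[OF continuous_map_compose[OF assms(3) this]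
      quotient_imp_continuous_map[OF quotient_map_proj]]
  show ?thesis by (simp add: o_def)
qed

lemma tclass_eq_proj: "tclass T P D E L a b \<psi> x y = proj ((a, b), (\<psi>, x, y))"
  by (simp add: tclass_def)

end

section \<open>The two homotopies\<close>

locale cut_P_space_pair =
  P_space_pair T P D E L + reparametrization_category T P + cut_structure P \<delta> c1 c2 \<Theta>
  for T and P :: "('o, 'm) semimonoidal" and D :: "('o, 'm, 'x) pspace" and E :: "('o, 'm, 'y) pspace"
    and L :: 'o and \<delta> c1 c2 \<Theta>
begin

abbreviation cut_pair :: "('o, 'm, 'x, 'y) triple \<Rightarrow> 'x \<times> 'y" where
  "cut_pair \<equiv> \<lambda>((a, b), (\<psi>, x, y)). (Act D L a (c1 L a b \<psi>) x, Act E L b (c2 L a b \<psi>) y)"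

lemma c_mor:
  assumes "a \<in> Ob P" "b \<in> Ob P" "\<psi> \<in> mor P L (tob P a b)"
  shows "c1 L a b \<psi> \<in> mor P L a" "c2 L a b \<psi> \<in> mor P L b"
  using funcset_mem[OF continuous_map_funspace[OF c1_continuous[OF L_Ob assms(1,2)]] assms(3)]
    funcset_mem[OF continuous_map_funspace[OF c2_continuous[OF L_Ob assms(1,2)]] assms(3)] by simp_all

lemma continuous_map_cut_pair: "continuous_map triples (Top_prod (Spc D L) (Spc E L)) cut_pair"
proof (rule continuous_map_from_triples)
  fix a b assume ab: "a \<in> Ob P" "b \<in> Ob P"
  note s = continuous_map_summand_coordinates[OF continuous_map_id[unfolded id_def], of a b]
  have "continuous_map (summand a b) (Top_prod (Spc D L) (Spc E L))
     (\<lambda>w. (Act D L a (c1 L a b (fst w)) (fst (snd w)), Act E L b (c2 L a b (fst w)) (snd (snd w))))"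
    using continuous_map_compose[OF s(1) c1_continuous[OF L_Ob ab]]
      continuous_map_compose[OF s(1) c2_continuous[OF L_Ob ab]] s(2,3) ab L_Ob
    by (intro continuous_map_into_Top_prod delta_generated_Top_prod D.continuous_map_Act E.continuous_map_Act)
      (simp_all add: o_def)
  then show "continuous_map (summand a b) (Top_prod (Spc D L) (Spc E L)) (\<lambda>w. cut_pair ((a, b), w))"
    by (simp add: case_prod_beta)
qed

lemma cut_pair_compatible: "coend_compatible cut_pair"
  unfolding coend_compatible_def
  by (intro ballI)
    (simp add: L_Ob c1_equivariant c2_equivariant D.Act_Comp E.Act_Comp c_mor)

lemma in_Top_prod_Spc: "in_Top T (Top_prod (Spc D L) (Spc E L))"
  by (intro in_Top_Top_prod D.Spc_in_Top E.Spc_in_Top L_Ob)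

lemma r_map_proj:
  assumes "z \<in> topspace triples"
  shows "r_map c1 c2 D E L (proj z) = cut_pair z"
  unfolding r_map_def
  by (simp add: constant_on_class[OF continuous_map_cut_pair in_Top_prod_Spc cut_pair_compatible assms])

lemma continuous_map_r:
  "continuous_map (Spc (tensor T P D E) L) (Top_prod (Spc D L) (Spc E L)) (r_map c1 c2 D E L)"
  using r_map_proj continuous_map_cut_pair by (rule continuous_map_from_tensor)

lemma s_map_eq: "s_map T P \<delta> D E L (x, y) = proj ((L, L), (\<delta> L, x, y))"
  by (simp add: s_map_def tclass_eq_proj)

lemma continuous_map_s:
  "continuous_map (Top_prod (Spc D L) (Spc E L)) (Spc (tensor T P D E) L) (s_map T P \<delta> D E L)"
proof -
  have "continuous_map (Top_prod (Spc D L) (Spc E L)) (summand L L) (\<lambda>w. (\<delta> L, w))"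
    using \<delta>_mor[OF L_Ob] by (intro continuous_map_into_Top_prod delta_generated_Top_prod) simp_all
  from continuous_map_component[OF L_Ob L_Ob this] show ?thesis
    by (rule continuous_map_eq) (auto simp: s_map_eq)
qed

abbreviation \<Theta>_class :: "real \<Rightarrow> ('o, 'm, 'x, 'y) triple \<Rightarrow> ('o, 'm, 'x, 'y) triple set" where
  "\<Theta>_class u \<equiv> \<lambda>((a, b), (\<psi>, x, y)). proj ((a, b), (\<Theta> L a b u \<psi>, x, y))"

lemma \<Theta>_mor:
  assumes "a \<in> Ob P" "b \<in> Ob P" "\<psi> \<in> mor P L (tob P a b)" "u \<in> {0..1}"
  shows "\<Theta> L a b u \<psi> \<in> mor P L (tob P a b)"
  using funcset_mem[OF continuous_map_funspace[OF \<Theta>_continuous[OF L_Ob assms(1,2)]], of "(u, \<psi>)"] assms by simp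

text \<open>\<open>\<Theta>\<close> is continuous on the product in Top of the interval with a hom-space. The ordinary product of the interval with a
  summand is Delta-generated, so its map to that product is continuous.\<close>

lemma continuous_map_\<Theta>_class:
  "continuous_map (prod_topology unit_interval triples) (Spc (tensor T P D E) L) (\<lambda>(u, z). \<Theta>_class u z)"
proof (rule continuous_map_interval_prod_triples)
  fix a b assume ab: "a \<in> Ob P" "b \<in> Ob P"
  let ?W = "prod_topology unit_interval (summand a b)"
  have W: "delta_generated ?W"
    by (rule delta_generated_interval_prod[OF delta_generated_Top_prod])
  note s = continuous_map_summand_coordinates[OF continuous_map_snd[of unit_interval "summand a b"]]
  have "continuous_map ?W (Hom P L (tob P a b)) (\<lambda>w. \<Theta> L a b (fst w) (fst (snd w)))"
    by (rule continuous_map_pointwise_Top_prod[OF \<Theta>_continuous[OF L_Ob ab] W continuous_map_fst s(1)])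
  then have "continuous_map ?W (summand a b)
      (\<lambda>w. (\<Theta> L a b (fst w) (fst (snd w)), (fst (snd (snd w)), snd (snd (snd w)))))"
    by (intro continuous_map_into_Top_prod W s(2,3))
  from continuous_map_component[OF ab this]
  show "continuous_map ?W (Spc (tensor T P D E) L)
      (\<lambda>v. case (fst v, (a, b), snd v) of (u, z) \<Rightarrow> \<Theta>_class u z)"
    by (simp add: case_prod_beta)
qed

lemma \<Theta>_class_compatible:
  assumes u: "u \<in> {0..1}"
  shows "coend_compatible (\<Theta>_class u)"
  unfolding coend_compatible_def
  by (intro ballI)
    (simp add: u L_Ob \<Theta>_equivariant[OF _ _ _ _ _ u] proj_generator \<Theta>_mor del: atLeastAtMost_iff)

lemma continuous_map_\<Theta>_class_fixed:
  assumes "u \<in> {0..1}"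
  shows "continuous_map triples (Spc (tensor T P D E) L) (\<Theta>_class u)"
proof -
  have "continuous_map triples (prod_topology unit_interval triples) (\<lambda>z. (u, z))"
    using assms by (intro continuous_map_pairedI) simp_all
  from continuous_map_compose[OF this continuous_map_\<Theta>_class] show ?thesis
    by (simp add: o_def)
qed

lemma \<Theta>_class_0: "z \<in> topspace triples \<Longrightarrow> \<Theta>_class 0 z = proj z"
  by (erule triplesE) (simp add: \<Theta>_0 L_Ob)

text \<open>At the end of the homotopy the morphism is \<open>(c1 \<psi> \<otimes> c2 \<psi>) \<delta>\<close>, and the coend relation turns its tensor factor into actions on the points.\<close>

lemma \<Theta>_class_1:
  assumes "z \<in> topspace triples"
  shows "\<Theta>_class 1 z = s_map T P \<delta> D E L (r_map c1 c2 D E L (proj z))"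
  using assms
proof (rule triplesE)
  fix a b \<psi> x y
  assume z: "z = ((a, b), (\<psi>, x, y))" "a \<in> Ob P" "b \<in> Ob P" "\<psi> \<in> mor P L (tob P a b)"
    "x \<in> topspace (Spc D a)" "y \<in> topspace (Spc E b)"
  have "\<Theta>_class 1 z = proj ((a, b), (post_tensor P L L a L b (c1 L a b \<psi>) (c2 L a b \<psi>) (\<delta> L), x, y))"
    using z by (simp add: \<Theta>_1 L_Ob cut_N_def)
  also have "\<dots> = proj ((L, L), (\<delta> L, Act D L a (c1 L a b \<psi>) x, Act E L b (c2 L a b \<psi>) y))"
    using z by (intro proj_generator L_Ob c_mor \<delta>_mor)
  also have "\<dots> = s_map T P \<delta> D E L (cut_pair z)"
    using z(1) by (simp add: s_map_eq)
  finally show ?thesis by (simp only: r_map_proj[OF assms])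
qed

text \<open>The homotopy is continuous on \<open>I \<times> triples\<close>. It descends to the coend because the product of the quotient map with the
  locally compact interval is again a quotient map.\<close>

lemma s_r_homotopic_id:
  "homotopic_with (\<lambda>_. True) (Spc (tensor T P D E) L) (Spc (tensor T P D E) L)
     (s_map T P \<delta> D E L \<circ> r_map c1 c2 D E L) id"
proof (rule homotopic_with_symD)
  let ?X = "Spc (tensor T P D E) L"
  define H where "H = (\<lambda>(u, C). the_elem (\<Theta>_class u ` C))"
  have H: "H (u, proj z) = \<Theta>_class u z" if "u \<in> {0..1}" "z \<in> topspace triples" for u z
    unfolding H_def
    using constant_on_class[OF continuous_map_\<Theta>_class_fixed[OF that(1)] in_Top_tensor
        \<Theta>_class_compatible[OF that(1)] that(2)] by simp
  have "quotient_map (prod_topology unit_interval triples) (prod_topology unit_interval ?X) (\<lambda>(u, z). (u, proj z))"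
    by (rule quotient_map_prod_right[OF _ _ quotient_map_proj])
      (simp_all add: compact_imp_locally_compact_space compact_space_subtopology Hausdorff_space_subtopology)
  then have "continuous_map (prod_topology unit_interval ?X) ?X H"
  proof (rule continuous_compose_quotient_map)
    show "continuous_map (prod_topology unit_interval triples) ?X (H \<circ> (\<lambda>(u, z). (u, proj z)))"
    proof (rule continuous_map_eq[OF continuous_map_\<Theta>_class])
      fix v assume "v \<in> topspace (prod_topology unit_interval triples)"
      then obtain u z where v: "v = (u, z)" "u \<in> {0..1}" "z \<in> topspace triples"
        by (cases v) simp
      show "(\<lambda>(u, z). \<Theta>_class u z) v = (H \<circ> (\<lambda>(u, z). (u, proj z))) v"
        using H[OF v(2,3)] by (simp only: v(1) o_def case_prod_conv)
    qed
  qed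
  moreover have "H (0, C) = id C \<and> H (1, C) = (s_map T P \<delta> D E L \<circ> r_map c1 c2 D E L) C"
    if C: "C \<in> topspace ?X" for C
    using C
  proof (rule tensorE)
    fix z assume z: "z \<in> topspace triples" "C = proj z"
    show ?thesis
      using H[of 0 z] H[of 1 z] \<Theta>_class_0[OF z(1)] \<Theta>_class_1[OF z(1)] z by simp
  qed
  ultimately show "homotopic_with (\<lambda>_. True) ?X ?X id (s_map T P \<delta> D E L \<circ> r_map c1 c2 D E L)"
    by (subst homotopic_with) auto
qed

text \<open>The composite acts on the factors by \<open>c1 (\<delta> L)\<close> and \<open>c2 (\<delta> L)\<close>. Contractibility of the endomorphism space of \<open>L\<close>
  provides the paths \<open>p\<close>, \<open>p'\<close> from these to the identity.\<close>

lemma r_s_homotopic_id: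
  "homotopic_with (\<lambda>_. True) (Top_prod (Spc D L) (Spc E L)) (Top_prod (Spc D L) (Spc E L))
     (r_map c1 c2 D E L \<circ> s_map T P \<delta> D E L) id"
proof -
  let ?Y = "Top_prod (Spc D L) (Spc E L)"
  let ?W = "prod_topology unit_interval ?Y"
  have "path_connected_space (Hom P L L)"
    by (rule contractible_imp_path_connected_space[OF Hom_contractible[OF L_Ob L_Ob]])
  then have path: "\<exists>p. pathin (Hom P L L) p \<and> p 0 = \<phi> \<and> p 1 = Idn P L" if "\<phi> \<in> mor P L L" for \<phi>
    using that Idn_mor[OF L_Ob] unfolding path_connected_space_def by blast
  note cm = c_mor[OF L_Ob L_Ob \<delta>_mor[OF L_Ob]]
  obtain p where p: "pathin (Hom P L L) p" "p 0 = c1 L L L (\<delta> L)" "p 1 = Idn P L"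
    using path[OF cm(1)] by blast
  obtain p' where p': "pathin (Hom P L L) p'" "p' 0 = c2 L L L (\<delta> L)" "p' 1 = Idn P L"
    using path[OF cm(2)] by blast
  define H where "H w = (Act D L L (p (fst w)) (fst (snd w)), Act E L L (p' (fst w)) (snd (snd w)))" for w
  have W: "delta_generated ?W"
    by (rule delta_generated_interval_prod[OF delta_generated_Top_prod])
  have c: "continuous_map ?W (Hom P L L) (\<lambda>w. q (fst w))" if "pathin (Hom P L L) q" for q
    using continuous_map_compose[OF continuous_map_fst that[unfolded pathin_def]] by (simp add: o_def)
  have cD: "continuous_map ?W (Spc D L) (\<lambda>w. fst (snd w))" and cE: "continuous_map ?W (Spc E L) (\<lambda>w. snd (snd w))"
    using continuous_map_compose[OF continuous_map_snd continuous_map_Top_prod_fst]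
      continuous_map_compose[OF continuous_map_snd continuous_map_Top_prod_snd] by (simp_all add: o_def)
  have "continuous_map ?W ?Y H"
    unfolding H_def
    by (intro continuous_map_into_Top_prod W D.continuous_map_Act E.continuous_map_Act L_Ob c p p' cD cE)
  moreover have "H (0, w) = (r_map c1 c2 D E L \<circ> s_map T P \<delta> D E L) w" "H (1, w) = id w"
    if "w \<in> topspace ?Y" for w
  proof -
    obtain x y where w: "w = (x, y)" by (cases w)
    then have xy: "x \<in> topspace (Spc D L)" "y \<in> topspace (Spc E L)" using that by simp_all
    have "((L, L), (\<delta> L, x, y)) \<in> topspace triples"
      using xy by (simp add: topspace_triples L_Ob \<delta>_mor)
    then show "H (0, w) = (r_map c1 c2 D E L \<circ> s_map T P \<delta> D E L) w"
      by (simp add: w s_map_eq r_map_proj H_def p p')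
    show "H (1, w) = id w" using xy by (simp add: w H_def p p' D.Act_Idn E.Act_Idn L_Ob)
  qed
  ultimately show ?thesis by (subst homotopic_with) auto
qed

lemma homotopy_inverses_r_s:
  "homotopy_inverses (Spc (tensor T P D E) L) (Top_prod (Spc D L) (Spc E L))
     (r_map c1 c2 D E L) (s_map T P \<delta> D E L)"
  unfolding homotopy_inverses_def
  using continuous_map_r continuous_map_s s_r_homotopic_id r_s_homotopic_id by blast

end

section \<open>Naturality\<close>

locale P_space_pair_map =
  P_space_pair T P D E L + D'E': P_space_pair T P D' E' L + f: P_space_map P D D' f + g: P_space_map P E E' g
  for T and P :: "('o, 'm) semimonoidal" and D :: "('o, 'm, 'x) pspace" and E :: "('o, 'm, 'y) pspace"
    and L :: 'o and D' :: "('o, 'm, 'x2) pspace" and E' :: "('o, 'm, 'y2) pspace" and f g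
begin

abbreviation triple_map :: "('o, 'm, 'x, 'y) triple \<Rightarrow> ('o, 'm, 'x2, 'y2) triple" where
  "triple_map \<equiv> \<lambda>((a, b), (\<psi>, x, y)). ((a, b), (\<psi>, f a x, g b y))"

lemma map_closed:
  "a \<in> Ob P \<Longrightarrow> x \<in> topspace (Spc D a) \<Longrightarrow> f a x \<in> topspace (Spc D' a)"
  "a \<in> Ob P \<Longrightarrow> y \<in> topspace (Spc E a) \<Longrightarrow> g a y \<in> topspace (Spc E' a)"
  using funcset_mem[OF continuous_map_funspace[OF f.component_continuous]]
    funcset_mem[OF continuous_map_funspace[OF g.component_continuous]] by blast+

lemma triple_map_closed: "z \<in> topspace triples \<Longrightarrow> triple_map z \<in> topspace D'E'.triples"
  by (erule triplesE) (simp add: D'E'.topspace_triples map_closed)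

text \<open>The set \<open>tensor_map \<dots> C\<close> is the union of the classes of the images of all representatives. By the universal
  property these classes coincide, which leaves the class of one image.\<close>

lemma tensor_map_proj:
  assumes z: "z \<in> topspace triples"
  shows "tensor_map T P D' E' f g L (proj z) = D'E'.proj (triple_map z)"
proof -
  let ?h = "\<lambda>z. D'E'.proj (triple_map z)"
  have "continuous_map triples (Spc (tensor T P D' E') L) ?h"
  proof (rule continuous_map_from_triples)
    fix a b assume ab: "a \<in> Ob P" "b \<in> Ob P"
    let ?W = "summand a b"
    have "continuous_map ?W (D'E'.summand a b) (\<lambda>w. (fst w, (f a (fst (snd w)), g b (snd (snd w)))))"
      using continuous_map_compose[OF continuous_map_compose[OF continuous_map_Top_prod_snd
            continuous_map_Top_prod_fst] f.component_continuous[OF ab(1)]]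
          continuous_map_compose[OF continuous_map_compose[OF continuous_map_Top_prod_snd
            continuous_map_Top_prod_snd] g.component_continuous[OF ab(2)]]
      by (intro continuous_map_into_Top_prod delta_generated_Top_prod continuous_map_Top_prod_fst)
        (simp_all add: o_def)
    from D'E'.continuous_map_component[OF ab this]
    show "continuous_map ?W (Spc (tensor T P D' E') L) (\<lambda>w. ?h ((a, b), w))"
      by (simp add: case_prod_beta)
  qed
  moreover have "coend_compatible ?h"
    unfolding coend_compatible_def
    by (intro ballI) (simp add: f.naturality g.naturality D'E'.proj_generator map_closed)
  ultimately have const: "?h ` proj z = {?h z}"
    by (intro constant_on_class[OF _ D'E'.in_Top_tensor _ z])
  have "tensor_map T P D' E' f g L (proj z) = \<Union>(?h ` proj z)"
    unfolding tensor_map_def by (simp only: Image_eq_UN[of _ "triple_map ` _"] image_image)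
  then show ?thesis by (simp only: const) simp
qed

end

theorem theorem5p1:
  fixes T :: top_kind and P :: "('o, 'm) semimonoidal"
    and \<delta> :: "'o \<Rightarrow> 'm" and c1 c2 :: "'o \<Rightarrow> 'o \<Rightarrow> 'o \<Rightarrow> 'm \<Rightarrow> 'm"
    and \<Theta> :: "'o \<Rightarrow> 'o \<Rightarrow> 'o \<Rightarrow> real \<Rightarrow> 'm \<Rightarrow> 'm"
    and D :: "('o, 'm, 'x) pspace" and E :: "('o, 'm, 'y) pspace" and L :: 'o
  assumes "reparametrization_category T P"
    and "cut_structure P \<delta> c1 c2 \<Theta>"
    and "P_space T P D" and "P_space T P E"
    and "L \<in> Ob P"
  shows "(\<forall>a\<in>Ob P. \<forall>b\<in>Ob P. \<forall>\<psi>\<in>mor P L (tob P a b). \<forall>x\<in>topspace (Spc D a). \<forall>y\<in>topspace (Spc E b).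
            r_map c1 c2 D E L (tclass T P D E L a b \<psi> x y) =
              (Act D L a (c1 L a b \<psi>) x, Act E L b (c2 L a b \<psi>) y)) \<and>
         homotopy_inverses (Spc (tensor T P D E) L) (Top_prod (Spc D L) (Spc E L))
           (r_map c1 c2 D E L) (s_map T P \<delta> D E L) \<and>
         Spc (tensor T P D E) L homotopy_equivalent_space Top_prod (Spc D L) (Spc E L) \<and>
         (\<forall>(D' :: ('o, 'm, 'x2) pspace) (E' :: ('o, 'm, 'y2) pspace) f g.
            P_space T P D' \<and> P_space T P E' \<and> P_space_map P D D' f \<and> P_space_map P E E' g \<longrightarrow>
            (\<forall>z\<in>topspace (Spc (tensor T P D E) L).
               r_map c1 c2 D' E' L (tensor_map T P D' E' f g L z) =
                 map_prod (f L) (g L) (r_map c1 c2 D E L z)) \<and>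
            (\<forall>x\<in>topspace (Spc D L). \<forall>y\<in>topspace (Spc E L).
               tensor_map T P D' E' f g L (s_map T P \<delta> D E L (x, y)) =
                 s_map T P \<delta> D' E' L (f L x, g L y)))"
proof -
  interpret reparametrization_category T P by fact
  interpret cut_structure P \<delta> c1 c2 \<Theta> by fact
  have pair: "P_space_pair T P D'' E'' L" if "P_space T P D''" "P_space T P E''"
    for D'' :: "('o, 'm, 'u) pspace" and E'' :: "('o, 'm, 'v) pspace"
    using that assms(5) strict_semimonoidal_Top_category_axioms
    by (intro P_space_pair.intro P_space_pair_axioms.intro)
  interpret DE: cut_P_space_pair T P D E L \<delta> c1 c2 \<Theta>
    by (intro cut_P_space_pair.intro pair assms)
  have formula: "r_map c1 c2 D E L (tclass T P D E L a b \<psi> x y) =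
      (Act D L a (c1 L a b \<psi>) x, Act E L b (c2 L a b \<psi>) y)"
    if "a \<in> Ob P" "b \<in> Ob P" "\<psi> \<in> mor P L (tob P a b)" "x \<in> topspace (Spc D a)" "y \<in> topspace (Spc E b)"
    for a b \<psi> x y
    using that by (simp add: DE.tclass_eq_proj DE.r_map_proj DE.topspace_triples)
  have equivalent: "Spc (tensor T P D E) L homotopy_equivalent_space Top_prod (Spc D L) (Spc E L)"
    using DE.homotopy_inverses_r_s unfolding homotopy_inverses_def homotopy_equivalent_space_def by blast
  have natural: "(\<forall>z\<in>topspace (Spc (tensor T P D E) L).
               r_map c1 c2 D' E' L (tensor_map T P D' E' f g L z) =
                 map_prod (f L) (g L) (r_map c1 c2 D E L z)) \<and>
            (\<forall>x\<in>topspace (Spc D L). \<forall>y\<in>topspace (Spc E L).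
               tensor_map T P D' E' f g L (s_map T P \<delta> D E L (x, y)) =
                 s_map T P \<delta> D' E' L (f L x, g L y))"
    if D': "P_space T P D'" and E': "P_space T P E'" and f: "P_space_map P D D' f" and g: "P_space_map P E E' g"
    for D' :: "('o, 'm, 'x2) pspace" and E' :: "('o, 'm, 'y2) pspace" and f g
  proof -
    interpret D'E': cut_P_space_pair T P D' E' L \<delta> c1 c2 \<Theta>
      by (intro cut_P_space_pair.intro pair assms D' E')
    interpret M: P_space_pair_map T P D E L D' E' f g
      by (intro P_space_pair_map.intro pair assms D' E' f g)
    show ?thesis
    proof (intro conjI ballI)
      fix C assume "C \<in> topspace (Spc (tensor T P D E) L)"
      then obtain z where z: "z \<in> topspace DE.triples" "C = DE.proj z" by (rule DE.tensorE)
      have "D'E'.cut_pair (M.triple_map z) = map_prod (f L) (g L) (DE.cut_pair z)"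
        using z(1) by (rule DE.triplesE)
          (simp add: M.f.naturality M.g.naturality DE.c_mor assms(5))
      then show "r_map c1 c2 D' E' L (tensor_map T P D' E' f g L C) =
          map_prod (f L) (g L) (r_map c1 c2 D E L C)"
        by (simp only: z(2) M.tensor_map_proj[OF z(1)] DE.r_map_proj[OF z(1)]
            D'E'.r_map_proj[OF M.triple_map_closed[OF z(1)]])
    next
      fix x y assume "x \<in> topspace (Spc D L)" "y \<in> topspace (Spc E L)"
      then have "((L, L), (\<delta> L, x, y)) \<in> topspace DE.triples"
        by (simp add: DE.topspace_triples \<delta>_mor assms(5))
      from M.tensor_map_proj[OF this]
      show "tensor_map T P D' E' f g L (s_map T P \<delta> D E L (x, y)) = s_map T P \<delta> D' E' L (f L x, g L y)"
        by (simp add: DE.s_map_eq D'E'.s_map_eq)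
    qed
  qed
  show ?thesis
    using formula DE.homotopy_inverses_r_s equivalent natural by blast
qed

end
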